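(* Consider the $N$ discrete-time agents $$x_i(t+1)=Ax_i(t)+Bu_i(t)+d_i(t),\qquad y_i(t)=Cx_i(t),\qquad i=1,\dots,N,\ t=0,1,2,\dots$$ with $x_i(t)\in\mathbb{R}^{n_x}$, $u_i(t)\in\mathbb{R}^{n_u}$, $y_i(t)\in\mathbb{R}$, with $(C,A,B)$ minimal, and with disturbances $d_i(t)=Ew_i(t)$, $w_i(t+1)=Sw_i(t)$, $w_i(t)\in\mathbb{R}^{n_w}$, where $S$ has no eigenvalue inside the unit circle of the complex plane. Let $f_i:\mathbb{R}\to\mathbb{R}$ be the local cost function of agent $i$, and let $\mathcal{G}$ be the weighted communication digraph on $\{1,\dots,N\}$ with adjacency matrix $[a_{ij}]$. Suppose that: (1) every $f_i$ is $\underline{l}$-strongly convex and $\nabla f_i$ is $\bar l$-Lipschitz; (2) $\mathcal{G}$ is strongly connected and weight-balanced; (3) there are constant matrices $X_1,X_2,U_1,U_2$ of compatible dimensions with $$X_1=AX_1+BU_1,\quad 1=CX_1,\qquad X_2S=AX_2+BU_2+E,\quad \mathbf{0}^{\mathrm T}=CX_2;$$ (4) the pair $\left(\begin{bmatrix}C&\mathbf 0\end{bmatrix},\begin{bmatrix}A&E\\ \mathbf 0&S\end{bmatrix}\right)$ is observable. Let $y^*=\arg\min_{s\in\mathbb{R}}\sum_{i=1}^N f_i(s)$. Then the optimal output consensus problem (as defined in the context) is solved by the distributed controller $$\begin{aligned} u_i(t)&=K\tilde x_i(t)+K_1z_i(t)+K_2\tilde w_i(t),\\ \tilde x_i(t+1)&=(A+L_1C)\tilde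 x_i(t)+Bu_i(t)+E\tilde w_i(t)-L_1y_i(t),\\ \tilde w_i(t+1)&=S\tilde w_i(t)+L_2\big(C\tilde x_i(t)-y_i(t)\big),\\ z_i(t+1)&=z_i(t)-\gamma\Big(\alpha\nabla f_i(z_i(t))+\beta\sum_{j=1}^N a_{ij}(z_i(t)-z_j(t))+\sum_{j=1}^N a_{ij}(\lambda_i(t)-\lambda_j(t))\Big),\\ \lambda_i(t+1)&=\lambda_i(t)+\gamma\alpha\beta\sum_{j=1}^N a_{ij}(z_i(t)-z_j(t)), \end{aligned}$$ $i=1,\dots,N$, $t=0,1,\dots$, where $K$ is chosen such that $A+BK$ is Schur stable, $K_1=U_1-KX_1$, $K_2=U_2-KX_2$, the matrices $L_1,L_2$ are chosen such that $\begin{bmatrix}A+L_1C&E\\ L_2C&S\end{bmatrix}$ is Schur stable, and $\alpha,\beta,\gamma$ are chosen such that $$\alpha\ge\max\Big\{1,\frac1{\underline l},\frac{2\bar l^2}{\underline l\lambda_2}\Big\},\qquad \beta\ge\max\Big\{1,\frac{4\alpha^2\lambda_N^2}{\lambda_2^2}\Big\},\qquad 0<\gamma<\frac{1}{\beta^4(\lambda_N^2+\bar l^2)}.$$ That is, under this controller all trajectories of the agents are bounded and $\lim_{t\to+\infty}|y_i(t)-y^*|=0$ for every $i=1,\dots,N$.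
   Context: Optimal output consensus problem: given the agents, the cost functions $f_i$, the graph $\mathcal{G}$ and the disturbances, find a feedback control $u_i$ for each agent $i$, using only its own and its neighbors' information, such that all trajectories of the agents are bounded and the resulting outputs satisfy $\lim_{t\to+\infty}|y_i(t)-y^*|=0$ for all $i=1,\dots,N$. Minimal means $(A,B)$ controllable and $(C,A)$ observable. A square matrix is Schur stable if all its eigenvalues lie strictly inside the unit circle. A weighted digraph on $\{1,\dots,N\}$ has adjacency matrix $\mathcal{A}=[a_{ij}]$ with $a_{ii}=0$, $a_{ij}\ge0$, where $a_{ij}>0$ iff $(j,i)$ is an edge (agent $i$ can get information of agent $j$). It is strongly connected if there is a directed path between any two vertices, and weight-balanced if $\sum_j a_{ij}=\sum_j a_{ji}$ for every $i$. Its Laplacian is $L=\mathrm{diag}(\sum_j a_{1j},\dots,\sum_j a_{Nj})-\mathcal{A}$. For a strongly connected weight-balanced digraph, $\mathrm{Sym}(L)=\frac{L+L^{\mathrm T}}2$ is positive semidefinite with simple eigenvalue $0$; its eigenvalues are ordered as $\lambda_1=0<\lambda_2\le\dots\le\lambda_N$ (these constants $\lambda_2,\lambda_N$ in the parameter conditions are not to be confused with the controller states $\lambda_i(t)\in\mathbb{R}$). A differentiable $f$ is $\omega$-strongly convex ($\omega>0$) if $(\nabla f(\zeta_1)-\nabla f(\zeta_2))^{\mathrm T}(\zeta_1-\zeta_2)\ge\omega|\zeta_1-\zeta_2|^2$ for all $\zeta_1,\zeta_2$; a map $g$ is $\vartheta$-Lipschitz if $|g(\zeta_1)-g(\zeta_2)|\le\vartheta|\zeta_1-\zeta_2|$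 for all $\zeta_1,\zeta_2$. The minimizer $y^*$ is unique and finite.
   Formalization: Boundedness of x_i, u_i and the observer states is claimed only for agents whose disturbance d_i is bounded, since S may generate growing disturbances for which it fails; output convergence and boundedness of y_i, z_i, λ_i hold for all initial data. *)

theory Defs
  imports "HOL-Analysis.Analysis"
begin

section \<open>Discrete-time linear systems\<close>

primrec state_trajectory ::
  "real^'n^'n \<Rightarrow> real^'m^'n \<Rightarrow> real^'n \<Rightarrow> (nat \<Rightarrow> real^'m) \<Rightarrow> nat \<Rightarrow> real^'n" where
  "state_trajectory A B x0 u 0 = x0"
| "state_trajectory A B x0 u (Suc t) = A *v state_trajectory A B x0 u t + B *v u t"

definition controllable :: "real^'n^'n \<Rightarrow> real^'m^'n \<Rightarrow> bool" where
  "controllable A B \<longleftrightarrow> (\<forall>x0 x1. \<exists>u T. state_trajectory A B x0 u T = x1)"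

(* Iterates are used because the power operation on the type of matrices is componentwise. *)

definition observable :: "real^'n^'p \<Rightarrow> real^'n^'n \<Rightarrow> bool" where
  "observable C A \<longleftrightarrow>
     (\<forall>x0 x0'. (\<forall>t. C *v (((*v) A ^^ t) x0) = C *v (((*v) A ^^ t) x0')) \<longrightarrow> x0 = x0')"

definition minimal_triple :: "real^'n^'p \<Rightarrow> real^'n^'n \<Rightarrow> real^'m^'n \<Rightarrow> bool" where
  "minimal_triple C A B \<longleftrightarrow> controllable A B \<and> observable C A"

definition complex_eigenvalues :: "real^'n^'n \<Rightarrow> complex set" where
  "complex_eigenvalues A =
     {\<mu>. \<exists>v. v \<noteq> 0 \<and> map_matrix complex_of_real A *v v = \<mu> *s v}"

definition Schur_stable :: "real^'n^'n \<Rightarrow> bool" where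
  "Schur_stable A \<longleftrightarrow> (\<forall>\<mu> \<in> complex_eigenvalues A. cmod \<mu> < 1)"

definition row_block :: "real^'n^'p \<Rightarrow> real^'m^'p \<Rightarrow> real^('n + 'm)^'p" where
  "row_block P Q = (\<chi> i j. case j of Inl a \<Rightarrow> P $ i $ a | Inr b \<Rightarrow> Q $ i $ b)"

definition col_block :: "real^'n^'p \<Rightarrow> real^'n^'q \<Rightarrow> real^'n^('p + 'q)" where
  "col_block P Q = (\<chi> i. case i of Inl a \<Rightarrow> P $ a | Inr b \<Rightarrow> Q $ b)"

definition block_matrix ::
  "real^'n^'p \<Rightarrow> real^'m^'p \<Rightarrow> real^'n^'q \<Rightarrow> real^'m^'q \<Rightarrow> real^('n + 'm)^('p + 'q)" where
  "block_matrix P Q R S = col_block (row_block P Q) (row_block R S)"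


section \<open>Weighted digraphs\<close>

definition adjacency_matrix :: "real^'N^'N \<Rightarrow> bool" where
  "adjacency_matrix a \<longleftrightarrow> (\<forall>i. a $ i $ i = 0) \<and> (\<forall>i j. a $ i $ j \<ge> 0)"

definition edges :: "real^'N^'N \<Rightarrow> ('N \<times> 'N) set" where
  "edges a = {(j, i). a $ i $ j > 0}"

definition strongly_connected :: "real^'N^'N \<Rightarrow> bool" where
  "strongly_connected a \<longleftrightarrow> (\<forall>i j. (i, j) \<in> (edges a)\<^sup>*)"

definition weight_balanced :: "real^'N^'N \<Rightarrow> bool" where
  "weight_balanced a \<longleftrightarrow> (\<forall>i. (\<Sum>j\<in>UNIV. a $ i $ j) = (\<Sum>j\<in>UNIV. a $ j $ i))"

definition Laplacian :: "real^'N^'N \<Rightarrow> real^'N^'N" where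
  "Laplacian a = (\<chi> i j. if i = j then (\<Sum>k\<in>UNIV. a $ i $ k) else 0) - a"

definition Sym :: "real^'N^'N \<Rightarrow> real^'N^'N" where
  "Sym M = (1/2) *\<^sub>R (M + transpose M)"

(* ev 1 \<le> ... \<le> ev n are the eigenvalues of M, listed with algebraic multiplicity:
   det (s I - M) = (s - ev 1) ... (s - ev n). *)
definition ordered_eigenvalues :: "real^'n^'n \<Rightarrow> (nat \<Rightarrow> real) \<Rightarrow> bool" where
  "ordered_eigenvalues M ev \<longleftrightarrow>
     mono_on {1..CARD('n)} ev \<and> (\<forall>s. det (mat s - M) = (\<Prod>k=1..CARD('n). s - ev k))"


section \<open>Cost functions\<close>

definition strongly_convex :: "real \<Rightarrow> (real \<Rightarrow> real) \<Rightarrow> bool" where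
  "strongly_convex \<omega> f \<longleftrightarrow> \<omega> > 0 \<and> (\<forall>s. f differentiable (at s)) \<and>
     (\<forall>s1 s2. (deriv f s1 - deriv f s2) * (s1 - s2) \<ge> \<omega> * \<bar>s1 - s2\<bar>\<^sup>2)"

end

theory Submission
  imports Defs "HOL-Computational_Algebra.Fundamental_Theorem_Algebra"
begin

text \<open>The optimal-signal generator \<open>(z, \<Lambda>)\<close> is autonomous and converges by a Lyapunov argument;
  every \<open>z i\<close> then tends to the minimizer. The observer errors \<open>(xt - x, wt - w)\<close> obey a Schur stable
  recursion, and by the regulator equations \<open>\<xi> = x - X1 z - X2 w\<close> obeys \<open>\<xi>(t+1) = (A + B K) \<xi>(t)\<close> up to
  a perturbation built from the observer errors and \<open>z(t+1) - z(t)\<close>, which vanishes asymptotically.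
  Hence \<open>\<xi>\<close> tends to 0, and with it \<open>y - z = C \<xi>\<close>. When the disturbance \<open>E w\<close> is bounded,
  observability of \<open>(E, S)\<close>, which follows from that of the cascade, makes \<open>w\<close> bounded, and then all
  states are bounded.\<close>

section \<open>Schur stable recursions\<close>

text \<open>The modes of \<open>S\<close> may lie outside the unit circle, so the disturbance may
  grow. The state follows \<open>X1 z + X2 w\<close> and may then grow as well, while
  \<open>C ** X2 = 0\<close> hides \<open>w\<close> from the output. So \<open>y\<close>,
  \<open>z\<close> and \<open>\<Lambda>\<close> are bounded in every case, but \<open>x\<close>,
  \<open>u\<close>, \<open>xt\<close>, \<open>wt\<close> only relative to \<open>d\<close>. Even a
  bounded \<open>E w\<close> says nothing about modes of \<open>S\<close> that \<open>E\<close> does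
  not see, and \<open>wt\<close> tracks all of \<open>w\<close>; this is where observability enters.
  The graph is directed: its Laplacian need not be symmetric, while the gain conditions mention only
  eigenvalues of the symmetric part. Norms of \<open>L v\<close> and mixed products
  \<open>u \<bullet> L v\<close> are therefore bounded through the quadratic form
  \<open>v \<bullet> L v\<close>. This costs a ratio of the largest to the smallest nonzero
  eigenvalue, and the lower bound on \<open>\<beta>\<close> is what pays for it.\<close>

lemma perturbed_contraction_tendsto_zero:
  fixes r e :: "nat \<Rightarrow> real"
  assumes \<rho>: "0 \<le> \<rho>" "\<rho> < 1" and nonneg: "\<And>t. 0 \<le> r t"
    and step: "\<And>t. r (Suc t) \<le> \<rho> * r t + e t" and e: "e \<longlonglongrightarrow> 0"
  shows "r \<longlonglongrightarrow> 0"
proof (rule LIMSEQ_I)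
  fix \<epsilon> :: real assume "\<epsilon> > 0"
  \<comment> \<open>With this \<delta>, the fixed point of
    \<open>r \<mapsto> \<rho> * r + \<delta>\<close> is \<open>\<epsilon> / 2\<close>.\<close>
  define \<delta> where "\<delta> = \<epsilon> * (1 - \<rho>) / 2"
  have "\<delta> > 0" using \<open>\<epsilon> > 0\<close> \<rho> by (simp add: \<delta>_def)
  then obtain T where T: "\<And>t. t \<ge> T \<Longrightarrow> \<bar>e t\<bar> < \<delta>"
    using LIMSEQ_D[OF e] by (metis diff_zero real_norm_def)
  have bound: "r (T + k) \<le> \<rho> ^ k * r T + \<epsilon> / 2" for k
  proof (induction k)
    case 0
    then show ?case using \<open>\<epsilon> > 0\<close> by simp
  next
    case (Suc k)
    have "r (T + Suc k) \<le> \<rho> * r (T + k) + \<delta>"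
      using step[of "T + k"] T[of "T + k"] by simp
    also have "\<dots> \<le> \<rho> * (\<rho> ^ k * r T + \<epsilon> / 2) + \<delta>"
      using Suc \<rho> by (simp add: mult_left_mono)
    also have "\<dots> = \<rho> ^ Suc k * r T + \<epsilon> / 2"
      by (simp add: \<delta>_def field_simps)
    finally show ?case .
  qed
  have "(\<lambda>k. \<rho> ^ k * r T) \<longlonglongrightarrow> 0"
    using \<rho> by (intro tendsto_mult_left_zero LIMSEQ_power_zero) auto
  from LIMSEQ_D[OF this, of "\<epsilon> / 2"] \<open>\<epsilon> > 0\<close>
  obtain k0 where k0: "\<And>k. k \<ge> k0 \<Longrightarrow> \<bar>\<rho> ^ k * r T\<bar> < \<epsilon> / 2" by auto
  have "norm (r t - 0) < \<epsilon>" if "t \<ge> T + k0" for t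
  proof -
    from that have "k0 \<le> t - T" "T + (t - T) = t" by simp_all
    with bound[of "t - T"] k0[of "t - T"] nonneg[of t] show ?thesis by auto
  qed
  then show "\<exists>no. \<forall>n\<ge>no. norm (r n - 0) < \<epsilon>" by blast
qed

lemma norm_vector_smult: "norm (c *s v) = cmod c * norm v" for v :: "complex^'n"
  by (simp add: norm_vec_def L2_set_right_distrib norm_mult)

lemma funpow_matrix_vector_mult:
  fixes M :: "'a::comm_semiring_1^'n^'n"
  shows "((*v) M ^^ k) v = (((**) M) ^^ k) (mat 1) *v v"
  by (induction k) (simp_all add: matrix_vector_mul_assoc)

lemma matrix_vector_mult_scaleR_left: "(c *\<^sub>R M) *v v = c *\<^sub>R (M *v v)" for M :: "complex^'n^'m"
  by (simp add: vec_eq_iff matrix_vector_mult_def scaleR_sum_right)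

lemma matrix_vector_mult_sum_left: "(\<Sum>k\<in>I. F k) *v v = (\<Sum>k\<in>I. F k *v v)"
  for F :: "'i \<Rightarrow> complex^'n^'m"
  by (induction I rule: infinite_finite_induct) (simp_all add: matrix_vector_mult_add_rdistrib)

text \<open>The powers \<open>M^0, ..., M^D\<close> are \<open>D + 1\<close> elements of a real
  space of dimension \<open>D\<close>. Any nonzero annihilator serves, because the peeling argument
  below also copes with roots that are not eigenvalues.\<close>

lemma annihilating_polynomial_exists:
  fixes M :: "complex^'n^'n"
  shows "\<exists>p. p \<noteq> 0 \<and> (\<forall>v. (\<Sum>k\<le>degree p. coeff p k *s ((*v) M ^^ k) v) = 0)"
proof -
  define P where "P k = (((**) M) ^^ k) (mat 1)" for k
  define D where "D = DIM(complex^'n^'n)"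
  have "\<exists>c k. k \<le> D \<and> c k \<noteq> (0::real) \<and> (\<Sum>k\<le>D. c k *\<^sub>R P k) = 0"
  \<comment> \<open>Linear dependence speaks of sets, so repeated powers would be lost; two equal
    powers give the annihilator \<open>X^i - X^j\<close> directly.\<close>
  proof (cases "inj_on P {..D}")
    case True
    then have "card (P ` {..D}) > D" by (simp add: card_image)
    then have "dependent (P ` {..D})"
      using independent_bound[of "P ` {..D}"] by (auto simp: D_def)
    then obtain g where g: "\<exists>v\<in>P ` {..D}. g v \<noteq> 0" "(\<Sum>v\<in>P ` {..D}. g v *\<^sub>R v) = 0"
      by (subst (asm) real_vector.dependent_finite) auto
    from g(2) have "(\<Sum>k\<le>D. g (P k) *\<^sub>R P k) = 0"
      by (subst (asm) sum.reindex[OF True]) simp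
    with g(1) show ?thesis by (intro exI[of _ "\<lambda>k. g (P k)"]) auto
  next
    case False
    then obtain i j where ij: "i \<le> D" "j \<le> D" "i \<noteq> j" "P i = P j"
      by (auto simp: inj_on_def)
    define c where "c k = (if k = i then 1 else 0) - (if k = j then 1 else 0 :: real)" for k
    have "(\<Sum>k\<le>D. c k *\<^sub>R P k) = P i - P j"
      using ij by (simp add: c_def scaleR_diff_left sum_subtractf if_distrib[of "\<lambda>x. x *\<^sub>R _"] cong: if_cong)
    with ij show ?thesis by (intro exI[of _ c] exI[of _ i]) (auto simp: c_def)
  qed
  then obtain c k0 where c: "k0 \<le> D" "c k0 \<noteq> 0" "(\<Sum>k\<le>D. c k *\<^sub>R P k) = 0" by blast
  define p where "p = (\<Sum>k\<le>D. monom (complex_of_real (c k)) k)"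
  have coeff_p: "coeff p k = (if k \<le> D then of_real (c k) else 0)" for k
    by (simp add: p_def coeff_sum)
  have "degree p \<le> D" by (rule degree_le) (simp add: coeff_p)
  have "(\<Sum>k\<le>degree p. coeff p k *s ((*v) M ^^ k) v) = 0" for v
  proof -
    have "(\<Sum>k\<le>degree p. coeff p k *s ((*v) M ^^ k) v) = (\<Sum>k\<le>D. coeff p k *s ((*v) M ^^ k) v)"
      using \<open>degree p \<le> D\<close> by (intro sum.mono_neutral_left) (auto simp: coeff_eq_0)
    also have "\<dots> = (\<Sum>k\<le>D. c k *\<^sub>R P k) *v v"
      unfolding matrix_vector_mult_sum_left matrix_vector_mult_scaleR_left P_def
        funpow_matrix_vector_mult[symmetric]
      by (intro sum.cong) (auto simp: coeff_p vec_eq_iff scaleR_conv_of_real[where 'a = complex])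
    finally show ?thesis by (simp add: c)
  qed
  moreover have "p \<noteq> 0" using c coeff_p[of k0] by auto
  ultimately show ?thesis by blast
qed

text \<open>Peel off one linear factor \<open>X - \<mu>\<close> at a time: if \<open>\<mu>\<close> lies inside the unit disc, then \<open>x\<close>
  obeys a perturbed contraction, and otherwise \<open>M - \<mu>\<close> is injective, hence bounded below.\<close>

lemma polynomial_annihilated_tendsto_zero:
  fixes M :: "complex^'n^'n" and x :: "nat \<Rightarrow> complex^'n" and p :: "complex poly"
  assumes stable: "\<And>\<mu> v. v \<noteq> 0 \<Longrightarrow> M *v v = \<mu> *s v \<Longrightarrow> cmod \<mu> < 1"
    and "p \<noteq> 0" and "(\<lambda>t. x (Suc t) - M *v x t) \<longlonglongrightarrow> 0"
    and "(\<lambda>t. \<Sum>k\<le>degree p. coeff p k *s ((*v) M ^^ k) (x t)) \<longlonglongrightarrow> 0"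
  shows "x \<longlonglongrightarrow> 0"
  using assms(2-)
proof (induction "degree p" arbitrary: p x)
  case 0
  then have c: "coeff p 0 \<noteq> 0" by (metis leading_coeff_0_iff)
  have "(\<lambda>t. norm (coeff p 0 *s x t)) \<longlonglongrightarrow> 0"
    using 0 by (intro tendsto_norm_zero) simp
  then have "(\<lambda>t. cmod (coeff p 0) * norm (x t)) \<longlonglongrightarrow> 0" by (simp add: norm_vector_smult)
  then show ?case using c by (simp add: tendsto_norm_zero_iff)
next
  case (Suc n)
  from Suc.hyps(2) have "\<not> constant (poly p)" by (simp add: constant_degree)
  then obtain \<mu> where "poly p \<mu> = 0" using fundamental_theorem_of_algebra by blast
  then obtain q where q: "p = [:-\<mu>, 1:] * q" by (auto simp: poly_eq_0_iff_dvd)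
  have "q \<noteq> 0" using q Suc.prems(1) by auto
  have deg_q: "degree q = n"
    using Suc.hyps(2) \<open>q \<noteq> 0\<close> unfolding q by (subst (asm) degree_mult_eq) auto
  define v where "v t = M *v x t - \<mu> *s x t" for t
  have lin: "linear (\<lambda>v. M *v v - \<mu> *s v)"
    by (rule linearI) (simp_all add: matrix_vector_right_distrib vector_add_ldistrib
      vec_eq_iff matrix_vector_mult_def scaleR_sum_right sum.distrib algebra_simps)
  \<comment> \<open>Since \<open>p = (X - \<mu>) q\<close>, applying \<open>q\<close> to
    \<open>(M - \<mu>) x\<close> is applying \<open>p\<close> to \<open>x\<close>. The coefficients
    of \<open>p\<close> are those of \<open>X q\<close>, a shift by one index, minus those of
    \<open>\<mu> q\<close>.\<close>
  have smult_v: "(\<Sum>k\<le>degree q. coeff q k *s ((*v) M ^^ k) (v t))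
      = (\<Sum>k\<le>degree p. coeff p k *s ((*v) M ^^ k) (x t))" for t
  proof -
    define y where "y k = ((*v) M ^^ k) (x t)" for k
    have y: "((*v) M ^^ k) (v t) = y (Suc k) - \<mu> *s y k" for k
      by (induction k) (simp_all add: v_def y_def vec.diff vec.scale)
    have "(\<Sum>k\<le>degree p. coeff p k *s y k) = (\<Sum>k\<le>Suc n. coeff (pCons 0 q) k *s y k)
        - (\<Sum>k\<le>Suc n. (\<mu> * coeff q k) *s y k)"
      unfolding Suc.hyps(2)[symmetric] sum_subtractf[symmetric]
      by (intro sum.cong) (auto simp: q vector_sub_rdistrib)
    also have "\<dots> = (\<Sum>k\<le>n. coeff q k *s y (Suc k)) - (\<Sum>k\<le>n. (\<mu> * coeff q k) *s y k)"
      using deg_q by (subst sum.atMost_Suc_shift) (simp add: coeff_eq_0)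
    also have "\<dots> = (\<Sum>k\<le>n. coeff q k *s (y (Suc k) - \<mu> *s y k))"
      unfolding sum_subtractf[symmetric]
      by (intro sum.cong) (auto simp: vec_eq_iff algebra_simps)
    finally show ?thesis by (simp add: y deg_q flip: y_def)
  qed
  have v: "v \<longlonglongrightarrow> 0"
  proof (rule Suc.hyps(1)[OF deg_q[symmetric] \<open>q \<noteq> 0\<close>])
    \<comment> \<open>\<open>M - \<mu>\<close> commutes with \<open>M\<close>, so \<open>v\<close>
      obeys the same recursion with the perturbation multiplied by \<open>M - \<mu>\<close>.\<close>
    have "v (Suc t) - M *v v t = M *v (x (Suc t) - M *v x t) - \<mu> *s (x (Suc t) - M *v x t)" for t
      by (simp add: v_def vec.diff vec.scale algebra_simps vec_eq_iff)
    moreover have "(\<lambda>t. M *v (x (Suc t) - M *v x t) - \<mu> *s (x (Suc t) - M *v x t)) \<longlonglongrightarrow> 0"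
      using linear_conv_bounded_linear lin Suc.prems(2)
      by (intro bounded_linear.tendsto_zero[of "\<lambda>v. M *v v - \<mu> *s v"]) auto
    ultimately show "(\<lambda>t. v (Suc t) - M *v v t) \<longlonglongrightarrow> 0" by simp
    show "(\<lambda>t. \<Sum>k\<le>degree q. coeff q k *s ((*v) M ^^ k) (v t)) \<longlonglongrightarrow> 0"
      using Suc.prems(3) by (simp add: smult_v)
  qed
  show ?case
  proof (cases "cmod \<mu> < 1")
    case True
    define e where "e t = norm (v t) + norm (x (Suc t) - M *v x t)" for t
    have "(\<lambda>t. norm (x t)) \<longlonglongrightarrow> 0"
    proof (rule perturbed_contraction_tendsto_zero)
      show "e \<longlonglongrightarrow> 0" unfolding e_def
        using v Suc.prems(2) by (intro tendsto_add_zero tendsto_norm_zero)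
      show "norm (x (Suc t)) \<le> cmod \<mu> * norm (x t) + e t" for t
      proof -
        have "x (Suc t) = \<mu> *s x t + v t + (x (Suc t) - M *v x t)" by (simp add: v_def)
        then have "norm (x (Suc t)) \<le> norm (\<mu> *s x t) + norm (v t) + norm (x (Suc t) - M *v x t)"
          by (metis norm_triangle_mono norm_triangle_ineq order_refl)
        then show ?thesis by (simp add: norm_vector_smult e_def)
      qed
    qed (use True in auto)
    then show ?thesis by (simp add: tendsto_norm_zero_iff)
  next
    case False
    then have "inj (\<lambda>v. M *v v - \<mu> *s v)"
      unfolding linear_injective_0[OF lin] using stable by force
    then obtain b where b: "b > 0" "\<And>u. b * norm u \<le> norm (M *v u - \<mu> *s u)"
      using linear_inj_bounded_below_pos[OF lin] by auto
    have "norm (x t) \<le> norm (v t) / b" for t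
      using b(2)[of "x t"] b(1) by (simp add: v_def field_simps)
    moreover have "(\<lambda>t. norm (v t) / b) \<longlonglongrightarrow> 0"
      using v by (intro tendsto_divide_zero tendsto_norm_zero)
    ultimately have "(\<lambda>t. norm (x t)) \<longlonglongrightarrow> 0"
      by (intro Lim_null_comparison[of "\<lambda>t. norm (x t)"]) auto
    then show ?thesis by (simp add: tendsto_norm_zero_iff)
  qed
qed

lemma Schur_stable_tendsto_zero:
  fixes A :: "real^'n^'n" and x b :: "nat \<Rightarrow> real^'n"
  assumes A: "Schur_stable A" and step: "\<And>t. x (Suc t) = A *v x t + b t" and b: "b \<longlonglongrightarrow> 0"
  shows "x \<longlonglongrightarrow> 0"
proof -
  \<comment> \<open>Complexification: over the complex numbers the annihilating polynomial splits
    into linear factors.\<close>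
  define c where "c v = (\<chi> i. complex_of_real (v $ i))" for v :: "real^'n"
  define M where "M = map_matrix complex_of_real A"
  have c_step: "c (x (Suc t)) - M *v c (x t) = c (b t)" for t
    by (simp add: vec_eq_iff c_def M_def map_matrix_def step matrix_vector_mult_def)
  have "(\<lambda>t. c (b t)) \<longlonglongrightarrow> (\<chi> i. 0)"
    unfolding c_def using tendsto_of_real[OF tendsto_vec_nth[OF b], where 'a = complex]
    by (intro tendsto_vec_lambda) simp
  then have cb: "(\<lambda>t. c (x (Suc t)) - M *v c (x t)) \<longlonglongrightarrow> 0"
    unfolding c_step by (simp add: zero_vec_def)
  obtain p where p: "p \<noteq> 0" "\<And>v. (\<Sum>k\<le>degree p. coeff p k *s ((*v) M ^^ k) v) = 0"
    using annihilating_polynomial_exists by metis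
  have "(\<lambda>t. c (x t)) \<longlonglongrightarrow> 0"
  proof (rule polynomial_annihilated_tendsto_zero[OF _ p(1) cb])
    show "cmod \<mu> < 1" if "v \<noteq> 0" "M *v v = \<mu> *s v" for \<mu> v
      using A that unfolding Schur_stable_def complex_eigenvalues_def M_def by blast
    show "(\<lambda>t. \<Sum>k\<le>degree p. coeff p k *s ((*v) M ^^ k) (c (x t))) \<longlonglongrightarrow> 0"
      by (simp add: p(2))
  qed
  then have "(\<lambda>t. Re (c (x t) $ i)) \<longlonglongrightarrow> 0" for i
    using tendsto_Re[OF tendsto_vec_nth] by fastforce
  then have "(\<lambda>t. x t $ i) \<longlonglongrightarrow> 0 $ i" for i by (simp add: c_def)
  then show ?thesis by (intro vec_tendstoI)
qed

section \<open>Laplacians of weight-balanced digraphs\<close>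

text \<open>The Rayleigh quotient attains its minimum on the compact unit sphere of
  \<open>U\<close>, and a vanishing first variation makes the minimizer an eigenvector. The
  invariant subspace \<open>U\<close> is kept general so that the constants can be split off from
  the Laplacian.\<close>

lemma rayleigh_minimum:
  fixes T :: "'a::euclidean_space \<Rightarrow> 'a"
  assumes T: "linear T" and self_adjoint: "\<And>u v. T u \<bullet> v = u \<bullet> T v"
    and U: "subspace U" "U \<noteq> {0}" "T ` U \<subseteq> U"
  obtains \<rho> v where "v \<in> U" "v \<noteq> 0" "T v = \<rho> *\<^sub>R v" "\<And>w. w \<in> U \<Longrightarrow> \<rho> * (w \<bullet> w) \<le> w \<bullet> T w"
proof -
  define K where "K = U \<inter> sphere 0 1"
  have "compact K"
    unfolding K_def using U by (simp add: closed_Int_compact closed_subspace)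
  moreover have "K \<noteq> {}"
  proof -
    obtain u where "u \<in> U" "u \<noteq> 0" using U subspace_0 by fastforce
    then have "u /\<^sub>R norm u \<in> K" using U by (simp add: K_def subspace_scale)
    then show ?thesis by blast
  qed
  moreover have "continuous_on K (\<lambda>w. w \<bullet> T w)"
    using T by (intro continuous_intros linear_continuous_on) (simp add: linear_conv_bounded_linear)
  ultimately obtain v where v: "v \<in> K" "\<And>w. w \<in> K \<Longrightarrow> v \<bullet> T v \<le> w \<bullet> T w"
    using continuous_attains_inf by metis
  define \<rho> where "\<rho> = v \<bullet> T v"
  have vv: "v \<bullet> v = 1" and vU: "v \<in> U"
    using v(1) by (simp_all add: K_def dot_square_norm)
  have min: "\<rho> * (w \<bullet> w) \<le> w \<bullet> T w" if "w \<in> U" for w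
  proof (cases "w = 0")
    case False
    then have "w /\<^sub>R norm w \<in> K" using that U by (simp add: K_def subspace_scale)
    then have "\<rho> \<le> (w /\<^sub>R norm w) \<bullet> T (w /\<^sub>R norm w)" unfolding \<rho>_def by (rule v(2))
    also have "\<dots> = (w \<bullet> T w) / (w \<bullet> w)"
      using T by (simp add: linear_scale dot_square_norm power2_eq_square field_simps)
    finally show ?thesis using False by (simp add: field_simps)
  qed (use T in \<open>simp add: linear_0\<close>)
  \<comment> \<open>The residual serves as test direction: moving from \<open>v\<close> by
    \<open>\<epsilon> *\<^sub>R g\<close> changes the excess over \<rho> by
    \<open>2 * \<epsilon> * (g \<bullet> g)\<close> to first order, and invariance keeps the move
    inside \<open>U\<close>.\<close>
  define g where "g = T v - \<rho> *\<^sub>R v"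
  have gU: "g \<in> U" using U vU unfolding g_def by (blast intro: subspace_diff subspace_scale)
  define c where "c = g \<bullet> T g - \<rho> * (g \<bullet> g)"
  have expand: "0 \<le> \<epsilon> * (2 * (g \<bullet> g) + \<epsilon> * c)" for \<epsilon>
  proof -
    have "v + \<epsilon> *\<^sub>R g \<in> U" using U vU gU by (blast intro: subspace_add subspace_scale)
    from min[OF this]
    have "\<rho> * (1 + 2 * \<epsilon> * (g \<bullet> v) + \<epsilon>\<^sup>2 * (g \<bullet> g)) \<le> \<rho> + \<epsilon> * (g \<bullet> T v) + \<epsilon> * (v \<bullet> T g) + \<epsilon>\<^sup>2 * (g \<bullet> T g)"
      using vv by (simp add: T linear_add linear_scale inner_add_left inner_add_right \<rho>_def[symmetric]
        inner_commute[of v g] power2_eq_square algebra_simps)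
    moreover have "v \<bullet> T g = g \<bullet> T v" by (metis self_adjoint inner_commute)
    moreover have "g \<bullet> T v = g \<bullet> g + \<rho> * (g \<bullet> v)"
      using inner_diff_right[of g "T v" "\<rho> *\<^sub>R v"] by (simp add: g_def[symmetric])
    ultimately show ?thesis by (simp add: c_def power2_eq_square algebra_simps)
  
  qed
  have "g \<bullet> g = 0"
  proof (rule ccontr)
    assume "g \<bullet> g \<noteq> 0"
    then have pos: "g \<bullet> g > 0" by (simp add: order_less_le)
    \<comment> \<open>Negative, and so small that the second-order term
      \<open>\<epsilon> * c\<close> cannot outweigh \<open>g \<bullet> g\<close>.\<close>
    define \<epsilon> where "\<epsilon> = - (g \<bullet> g) / (\<bar>c\<bar> + 1)"
    have "\<epsilon> < 0" using pos by (simp add: \<epsilon>_def divide_neg_pos)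
    have "\<bar>\<epsilon> * c\<bar> \<le> g \<bullet> g"
      using pos by (simp add: \<epsilon>_def abs_mult divide_simps mult_left_mono)
    with pos have "2 * (g \<bullet> g) + \<epsilon> * c > 0" by linarith
    with \<open>\<epsilon> < 0\<close> have "\<epsilon> * (2 * (g \<bullet> g) + \<epsilon> * c) < 0" by (simp add: mult_neg_pos)
    with expand[of \<epsilon>] show False by simp
  qed
  then have "T v = \<rho> *\<^sub>R v" by (simp add: g_def)
  moreover have "v \<noteq> 0" using vv by auto
  ultimately show ?thesis using that vU min by blast
qed

lemma dot_matrix_vector_transpose: "u \<bullet> (M *v v) = (transpose M *v u) \<bullet> v" for M :: "real^'n^'m"
  by (metis dot_lmul_matrix transpose_transpose vector_transpose_matrix)

lemma mat_diff_vector_mult: "(mat s - M) *v v = s *\<^sub>R v - M *v v" for M :: "real^'n^'n"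
proof -
  have "mat s *v v = s *\<^sub>R v"
    by (simp add: vec_eq_iff mat_def matrix_vector_mult_def if_distrib[of "\<lambda>x. x * _"] cong: if_cong)
  then show ?thesis by (simp add: matrix_vector_mult_diff_rdistrib)
qed

lemma det_eq_0_iff_kernel: "det M = 0 \<longleftrightarrow> (\<exists>v. v \<noteq> 0 \<and> M *v v = 0)" for M :: "real^'n^'n"
  using invertible_det_nz[of M] invertible_left_inverse[of M] matrix_left_invertible_ker[of M] by metis

text \<open>Only membership in the list is captured; the multiplicity, on which the meaning of
  \<open>ev 2\<close> rests, is settled by \<open>Sym_Laplacian_simple_kernel\<close>.\<close>

lemma ordered_eigenvalues_iff:
  fixes M :: "real^'n^'n"
  assumes "ordered_eigenvalues M ev"
  shows "(\<exists>k\<in>{1..CARD('n)}. ev k = \<rho>) \<longleftrightarrow> (\<exists>v. v \<noteq> 0 \<and> M *v v = \<rho> *\<^sub>R v)"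
proof -
  have "(\<exists>k\<in>{1..CARD('n)}. ev k = \<rho>) \<longleftrightarrow> det (mat \<rho> - M) = 0"
    using assms by (auto simp: ordered_eigenvalues_def)
  then show ?thesis by (auto simp: det_eq_0_iff_kernel mat_diff_vector_mult)
qed

text \<open>The Rayleigh minimum of \<open>- M\<close> over the whole space is minus an eigenvalue
  of \<open>M\<close>, and the ordering bounds that eigenvalue by the last one.\<close>

lemma dot_le_max_eigenvalue:
  fixes M :: "real^'n^'n"
  assumes ev: "ordered_eigenvalues M ev" and M: "transpose M = M"
  shows "v \<bullet> (M *v v) \<le> ev CARD('n) * (v \<bullet> v)"
proof -
  have "(UNIV :: (real^'n) set) \<noteq> {0}" using zero_neq_one by blast
  moreover have "linear (\<lambda>v. - (M *v v))"
    by (simp add: linear_compose_neg)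
  moreover have "- (M *v u) \<bullet> v = u \<bullet> - (M *v v)" for u v
    using dot_matrix_vector_transpose[of u M v] M by simp
  ultimately obtain \<rho> w where w: "w \<noteq> 0" "- (M *v w) = \<rho> *\<^sub>R w"
    and \<rho>: "\<And>u. \<rho> * (u \<bullet> u) \<le> u \<bullet> - (M *v u)"
    using rayleigh_minimum[of "\<lambda>v. - (M *v v)" UNIV] by (metis UNIV_I subspace_UNIV top_greatest)
  from w(2) have "M *v w = (- \<rho>) *\<^sub>R w" by (metis minus_minus scaleR_minus_left)
  then obtain k where k: "k \<in> {1..CARD('n)}" "ev k = - \<rho>"
    using ordered_eigenvalues_iff[OF ev, of "- \<rho>"] w(1) by blast
  have "ev k \<le> ev CARD('n)"
    using ev k(1) unfolding ordered_eigenvalues_def mono_on_def by auto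
  then have "- \<rho> * (v \<bullet> v) \<le> ev CARD('n) * (v \<bullet> v)"
    using k(2) by (intro mult_right_mono) auto
  with \<rho>[of v] show ?thesis by simp
qed

lemma transpose_Sym: "transpose (Sym M) = Sym M"
  by (simp add: Sym_def transpose_def vec_eq_iff add.commute)

lemma dot_Sym: "v \<bullet> (Sym M *v v) = v \<bullet> (M *v v)" for M :: "real^'n^'n"
proof -
  have "v \<bullet> (transpose M *v v) = v \<bullet> (M *v v)"
    by (metis dot_matrix_vector_transpose inner_commute)
  then show ?thesis
    by (simp add: Sym_def matrix_vector_mult_add_rdistrib inner_add_right
      flip: scaleR_matrix_vector_assoc)
qed

section \<open>Quadratic form and spectrum of the Laplacian\<close>

locale balanced_digraph =
  fixes a :: "real^'N::finite^'N"
  assumes adjacency: "adjacency_matrix a" and connected: "strongly_connected a"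
    and balanced: "weight_balanced a"
begin

lemma weight_nonneg: "0 \<le> a $ i $ j"
  using adjacency by (simp add: adjacency_matrix_def)

lemma Laplacian_mult: "(Laplacian a *v v) $ i = (\<Sum>j\<in>UNIV. a $ i $ j * (v $ i - v $ j))"
proof -
  have "(Laplacian a *v v) $ i = (\<Sum>j\<in>UNIV. (if i = j then (\<Sum>k\<in>UNIV. a $ i $ k) * v $ j else 0) - a $ i $ j * v $ j)"
    unfolding matrix_vector_mult_def Laplacian_def by (auto intro!: sum.cong simp: algebra_simps)
  then show ?thesis by (simp add: sum_subtractf right_diff_distrib sum_distrib_right)
qed

lemma Laplacian_one: "Laplacian a *v 1 = 0"
  by (simp add: vec_eq_iff Laplacian_mult)

lemma one_Laplacian: "1 \<bullet> (Laplacian a *v v) = 0"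
proof -
  have "(\<Sum>i\<in>UNIV. \<Sum>j\<in>UNIV. a $ i $ j * v $ i) = (\<Sum>i\<in>UNIV. \<Sum>j\<in>UNIV. a $ i $ j * v $ j)"
    using balanced unfolding weight_balanced_def
    by (subst (2) sum.swap) (simp flip: sum_distrib_right)
  then show ?thesis by (simp add: inner_vec_def Laplacian_mult right_diff_distrib sum_subtractf)
qed

text \<open>By weight balance, \<open>1 \<bullet> (L u) = 0\<close> for the vector \<open>u\<close>
  of the squares of the entries of \<open>v\<close>; subtracting this symmetrizes the form, as
  \<open>2 v_i (v_i - v_j) - (v_i^2 - v_j^2) = (v_i - v_j)^2\<close>.\<close>

lemma dirichlet_form: "v \<bullet> (Laplacian a *v v) = (\<Sum>i\<in>UNIV. \<Sum>j\<in>UNIV. a $ i $ j * (v $ i - v $ j)\<^sup>2) / 2"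
proof -
  have "1 \<bullet> (Laplacian a *v (\<chi> i. (v $ i)\<^sup>2)) = 0" by (rule one_Laplacian)
  then have "0 = (\<Sum>i\<in>UNIV. \<Sum>j\<in>UNIV. a $ i $ j * ((v $ i)\<^sup>2 - (v $ j)\<^sup>2))"
    by (simp add: inner_vec_def Laplacian_mult)
  moreover have "2 * (v \<bullet> (Laplacian a *v v)) - (\<Sum>i\<in>UNIV. \<Sum>j\<in>UNIV. a $ i $ j * ((v $ i)\<^sup>2 - (v $ j)\<^sup>2))
      = (\<Sum>i\<in>UNIV. \<Sum>j\<in>UNIV. a $ i $ j * (v $ i - v $ j)\<^sup>2)"
    by (simp add: inner_vec_def Laplacian_mult sum_distrib_left power2_eq_square algebra_simps flip: sum_subtractf sum.distrib)
  ultimately show ?thesis by simp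
qed

lemma dirichlet_form_nonneg: "0 \<le> v \<bullet> (Laplacian a *v v)"
  unfolding dirichlet_form by (simp add: sum_nonneg weight_nonneg)

lemma dirichlet_form_eq_0_imp_constant:
  assumes "v \<bullet> (Laplacian a *v v) = 0"
  shows "v $ i = v $ j"
proof -
  have eq: "a $ i $ j * (v $ i - v $ j)\<^sup>2 = 0" for i j
    using assms weight_nonneg unfolding dirichlet_form
    by (simp add: sum_nonneg_eq_0_iff sum_nonneg)
  then have edge: "v $ j = v $ i" if "(j, i) \<in> edges a" for i j
    using that eq[of i j] by (auto simp: edges_def)
  have "v $ i = v $ j" if "(i, j) \<in> (edges a)\<^sup>*" for i j
    using that by (induction rule: rtrancl_induct) (auto dest: edge)
  then show ?thesis using connected by (auto simp: strongly_connected_def)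
qed

lemma dirichlet_form_eq_0_imp_0:
  assumes "v \<bullet> (Laplacian a *v v) = 0" "1 \<bullet> v = 0"
  shows "v = 0"
proof -
  obtain i :: 'N where True by blast
  have "v $ j = v $ i" for j using dirichlet_form_eq_0_imp_constant[OF assms(1)] .
  then have "v = v $ i *\<^sub>R 1" by (simp add: vec_eq_iff)
  moreover from this assms(2) have "v $ i * (1 \<bullet> (1 :: real^'N)) = 0" by (metis inner_scaleR_right)
  ultimately show ?thesis by (metis inner_eq_zero_iff mult_eq_0_iff scaleR_zero_left zero_neq_one)
qed

lemma dirichlet_form_pos: "0 < v \<bullet> (Laplacian a *v v)" if "v \<noteq> 0" "1 \<bullet> v = 0"
  using dirichlet_form_nonneg[of v] dirichlet_form_eq_0_imp_0[of v] that by linarith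

lemma Sym_Laplacian_one: "Sym (Laplacian a) *v 1 = 0"
proof -
  have "(transpose (Laplacian a) *v 1) \<bullet> v = 0" for v
    by (metis dot_matrix_vector_transpose one_Laplacian)
  then have "transpose (Laplacian a) *v 1 = 0" by (metis inner_eq_zero_iff)
  then show ?thesis
    by (simp add: Sym_def matrix_vector_mult_add_rdistrib Laplacian_one flip: scaleR_matrix_vector_assoc)
qed

lemma one_Sym_Laplacian: "1 \<bullet> (Sym (Laplacian a) *v v) = 0"
  by (metis dot_matrix_vector_transpose inner_zero_left transpose_Sym Sym_Laplacian_one)

text \<open>Adding all other rows to row \<open>i0\<close> turns that row of \<open>mat s - Sym (Laplacian a)\<close> into \<open>s\<close> times
  the all-ones row; the matrix left after pulling out \<open>s\<close> is invertible at \<open>s = 0\<close>.\<close>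

lemma Sym_Laplacian_simple_kernel:
  assumes g: "\<And>s. s \<noteq> 0 \<Longrightarrow> det (mat s - Sym (Laplacian a)) = s * g s" and cont: "isCont g 0"
  shows "g 0 \<noteq> 0"
proof -
  define M where "M = Sym (Laplacian a)"
  obtain i0 :: 'N where True by blast
  define R :: "real \<Rightarrow> real^'N^'N" where "R s = (\<chi> k. if k = i0 then 1 else row k (mat s - M))" for s
  have det_R: "det (mat s - M) = s * det (R s)" for s
  proof -
    define D where "D = mat s - M"
    have sum_M: "(\<Sum>k\<in>UNIV. row k M) = 0"
    proof -
      have "(\<Sum>k\<in>UNIV. row k M) = transpose M *v 1"
        by (simp add: vec_eq_iff row_def transpose_def matrix_vector_mult_def)
      then show ?thesis by (simp add: M_def transpose_Sym Sym_Laplacian_one)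
    qed
    have "(\<Sum>k\<in>UNIV. row k D) = s *s 1"
    proof -
      have "(\<Sum>k\<in>UNIV. row k D) = (\<Sum>k\<in>UNIV. row k (mat s)) - (\<Sum>k\<in>UNIV. row k M)"
        unfolding sum_subtractf[symmetric] by (simp add: D_def row_def vec_eq_iff)
      then show ?thesis by (simp add: sum_M) (simp add: vec_eq_iff row_def mat_def)
    qed
    then have rows: "row i0 D + (\<Sum>k\<in>UNIV - {i0}. row k D) = s *s 1"
      by (metis UNIV_I finite sum.remove)
    have "(\<Sum>k\<in>UNIV - {i0}. row k D) \<in> vec.span {row j D |j. j \<noteq> i0}"
      by (intro vec.span_sum vec.span_base) auto
    from det_row_span[OF this] have "det D = det (\<chi> k. if k = i0 then s *s 1 else row k D)"
      by (simp add: rows cong: if_cong)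
    also have "\<dots> = s * det (\<chi> k. if k = i0 then 1 else row k D)" by (rule det_row_mul)
    finally show ?thesis unfolding D_def R_def .
  qed
  \<comment> \<open>The factorization fixes \<open>g\<close> only away from 0; continuity of both
    sides carries the equality over to 0.\<close>
  have "g s = det (R s)" if "s \<noteq> 0" for s
    using det_R[of s] g[OF that] that by (simp add: M_def)
  then have "(\<lambda>s. det (R s)) \<midarrow>0\<rightarrow> g 0"
    using cont unfolding isCont_def by (subst LIM_cong[of _ 0 _ g]) auto
  moreover have "isCont (\<lambda>s. det (R s)) 0"
  proof -
    have "isCont (\<lambda>s. R s $ i $ j) 0" for i j
      by (cases "i = i0"; cases "i = j") (simp_all add: R_def row_def mat_def)
    then show ?thesis
      unfolding det_def by (intro continuous_sum continuous_mult continuous_const continuous_prod)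
  qed
  ultimately have "g 0 = det (R 0)" unfolding isCont_def using LIM_unique by blast
  moreover have "det (R 0) \<noteq> 0"
  proof
    assume "det (R 0) = 0"
    then obtain v where v: "v \<noteq> 0" "R 0 *v v = 0" by (auto simp: det_eq_0_iff_kernel)
    have row_i0: "1 \<bullet> v = 0"
    proof -
      have "(R 0 *v v) $ i0 = 1 \<bullet> v"
        by (simp add: R_def matrix_vector_mult_def inner_vec_def)
      then show ?thesis using v by simp
    qed
    have other: "(M *v v) $ k = 0" if "k \<noteq> i0" for k
    proof -
      have "(R 0 *v v) $ k = - (M *v v) $ k"
        using that by (simp add: R_def row_def mat_def matrix_vector_mult_def sum_negf)
      then show ?thesis using v by simp
    qed
    \<comment> \<open>The entry at \<open>i0\<close>, whose row was replaced, follows from the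
      others because all entries of \<open>M *v v\<close> sum to 0.\<close>
    moreover have "(\<Sum>k\<in>UNIV. (M *v v) $ k) = 0"
      using one_Sym_Laplacian[of v] by (simp add: inner_vec_def M_def)
    ultimately have "M *v v = 0"
      by (metis (no_types, lifting) UNIV_I finite sum.neutral sum.remove add.right_neutral
        DiffE singletonI vec_eq_iff zero_index)
    then have "v \<bullet> (Laplacian a *v v) = 0" by (metis M_def dot_Sym inner_zero_right)
    with row_i0 v(1) show False using dirichlet_form_eq_0_imp_0 by blast
  qed
  ultimately show ?thesis by simp
qed

context
  fixes ev :: "nat \<Rightarrow> real"
  assumes ev: "ordered_eigenvalues (Sym (Laplacian a)) ev" and card: "CARD('N) \<ge> 2"
begin

lemma eigenvalue_nonneg:
  assumes "k \<in> {1..CARD('N)}"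
  shows "0 \<le> ev k"
proof -
  obtain v where v: "v \<noteq> 0" "Sym (Laplacian a) *v v = ev k *\<^sub>R v"
    using ordered_eigenvalues_iff[OF ev, of "ev k"] assms by blast
  have "ev k * (v \<bullet> v) = v \<bullet> (Laplacian a *v v)"
    using v(2) by (metis dot_Sym inner_scaleR_right)
  then show ?thesis
    using dirichlet_form_nonneg[of v] v(1) by (metis inner_gt_zero_iff zero_le_mult_iff not_less)
qed

lemma second_eigenvalue_pos: "0 < ev 2"
proof (rule ccontr)
  assume "\<not> 0 < ev 2"
  moreover have "ev 1 \<le> ev 2"
    using ev card unfolding ordered_eigenvalues_def mono_on_def by simp
  ultimately have ev0: "ev 1 = 0" "ev 2 = 0"
    using eigenvalue_nonneg[of 1] eigenvalue_nonneg[of 2] card by auto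
  \<comment> \<open>If 0 were listed twice, the quotient of the characteristic polynomial by
    \<open>s\<close> would still vanish at 0.\<close>
  define g where "g s = s * (\<Prod>k\<in>{3..CARD('N)}. s - ev k)" for s
  have "det (mat s - Sym (Laplacian a)) = s * g s" for s
  proof -
    have "{1..CARD('N)} = insert 1 (insert 2 {3..CARD('N)})" using card by auto
    then show ?thesis using ev by (simp add: ordered_eigenvalues_def g_def ev0[simplified])
  qed
  moreover have "isCont g 0" unfolding g_def by (intro continuous_intros)
  ultimately have "g 0 \<noteq> 0" by (rule Sym_Laplacian_simple_kernel)
  then show False by (simp add: g_def)
qed

text \<open>The Rayleigh minimum over the complement of the constants is a positive eigenvalue.
  Since 0 is in the ordered list too, its index cannot be 1, so it is at least
  \<open>ev 2\<close>.\<close>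

lemma dirichlet_form_ge:
  assumes "1 \<bullet> v = 0"
  shows "ev 2 * (v \<bullet> v) \<le> v \<bullet> (Laplacian a *v v)"
proof (cases "v = 0")
  case False
  define U :: "(real^'N) set" where "U = {v. 1 \<bullet> v = 0}"
  have "subspace U" unfolding U_def by (rule subspace_hyperplane)
  moreover have "U \<noteq> {0}" using assms False by (auto simp: U_def)
  moreover have "(*v) (Sym (Laplacian a)) ` U \<subseteq> U" by (auto simp: U_def one_Sym_Laplacian)
  moreover have "(Sym (Laplacian a) *v u) \<bullet> w = u \<bullet> (Sym (Laplacian a) *v w)" for u w
    by (metis dot_matrix_vector_transpose transpose_Sym)
  ultimately obtain \<rho> w where w: "w \<in> U" "w \<noteq> 0" "Sym (Laplacian a) *v w = \<rho> *\<^sub>R w"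
    and \<rho>: "\<And>u. u \<in> U \<Longrightarrow> \<rho> * (u \<bullet> u) \<le> u \<bullet> (Sym (Laplacian a) *v u)"
    using rayleigh_minimum[of "(*v) (Sym (Laplacian a))" U] by (metis matrix_vector_mul_linear)
  have "0 < \<rho>"
  proof -
    have "\<rho> * (w \<bullet> w) = w \<bullet> (Laplacian a *v w)" using w(3) by (metis dot_Sym inner_scaleR_right)
    then have "0 < \<rho> * (w \<bullet> w)" using dirichlet_form_pos w by (simp add: U_def)
    then show ?thesis by (metis inner_ge_zero not_less zero_less_mult_iff)
  qed
  obtain k where k: "k \<in> {1..CARD('N)}" "ev k = \<rho>"
    using ordered_eigenvalues_iff[OF ev, of \<rho>] w by blast
  obtain j where j: "j \<in> {1..CARD('N)}" "ev j = 0"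
    using ordered_eigenvalues_iff[OF ev, of 0] Sym_Laplacian_one zero_neq_one
    by (metis scaleR_zero_left)
  have mono: "ev p \<le> ev q" if "p \<in> {1..CARD('N)}" "q \<in> {1..CARD('N)}" "p \<le> q" for p q
    using ev that unfolding ordered_eigenvalues_def mono_on_def by blast
  have "k \<ge> 2"
  proof (rule ccontr)
    assume "\<not> k \<ge> 2"
    then have "ev k \<le> ev j" using k j by (intro mono) auto
    with k j \<open>0 < \<rho>\<close> show False by simp
  qed
  then have "ev 2 \<le> \<rho>" using mono[of 2 k] k by auto
  then have "ev 2 * (v \<bullet> v) \<le> \<rho> * (v \<bullet> v)" by (simp add: mult_right_mono)
  also have "\<dots> \<le> v \<bullet> (Laplacian a *v v)" using \<rho>[of v] assms by (simp add: U_def dot_Sym)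
  finally show ?thesis .
qed simp

lemma dirichlet_form_le: "v \<bullet> (Laplacian a *v v) \<le> ev CARD('N) * (v \<bullet> v)"
  using dot_le_max_eigenvalue[OF ev transpose_Sym] by (simp add: dot_Sym)

text \<open>Test the quadratic form on a unit coordinate vector; without self-loops it returns the
  row sum.\<close>

lemma out_degree_le: "(\<Sum>j\<in>UNIV. a $ i $ j) \<le> ev CARD('N)"
proof -
  have "axis i 1 \<bullet> (Laplacian a *v axis i 1) = (\<Sum>j\<in>UNIV. a $ i $ j * (1 - axis i 1 $ j))"
    by (simp add: inner_axis' Laplacian_mult)
  also have "\<dots> = (\<Sum>j\<in>UNIV. a $ i $ j)"
    using adjacency by (intro sum.cong) (auto simp: axis_def adjacency_matrix_def)
  finally show ?thesis using dirichlet_form_le[of "axis i 1"] by (simp add: inner_axis')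
qed

text \<open>For a directed graph the operator norm of the Laplacian may exceed \<open>ev CARD('N)\<close>, the largest
  eigenvalue of the symmetric part only; this is the replacement.\<close>

lemma Laplacian_dot_le: "(Laplacian a *v v) \<bullet> (Laplacian a *v v) \<le> 2 * ev CARD('N) * (v \<bullet> (Laplacian a *v v))"
proof -
  have row: "((Laplacian a *v v) $ i)\<^sup>2 \<le> ev CARD('N) * (\<Sum>j\<in>UNIV. a $ i $ j * (v $ i - v $ j)\<^sup>2)" for i
  proof -
    \<comment> \<open>Each weight is split into two square roots for Cauchy-Schwarz, so that one
      factor becomes the row sum and the other a part of the Dirichlet form.\<close>
    have "((Laplacian a *v v) $ i)\<^sup>2 = (\<Sum>j\<in>UNIV. sqrt (a $ i $ j) * (sqrt (a $ i $ j) * (v $ i - v $ j)))\<^sup>2"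
      unfolding Laplacian_mult by (simp add: weight_nonneg flip: mult.assoc)
    also have "\<dots> \<le> (\<Sum>j\<in>UNIV. (sqrt (a $ i $ j))\<^sup>2) * (\<Sum>j\<in>UNIV. (sqrt (a $ i $ j) * (v $ i - v $ j))\<^sup>2)"
      by (rule Cauchy_Schwarz_ineq_sum)
    also have "\<dots> = (\<Sum>j\<in>UNIV. a $ i $ j) * (\<Sum>j\<in>UNIV. a $ i $ j * (v $ i - v $ j)\<^sup>2)"
      by (simp add: power_mult_distrib weight_nonneg)
    also have "\<dots> \<le> ev CARD('N) * (\<Sum>j\<in>UNIV. a $ i $ j * (v $ i - v $ j)\<^sup>2)"
      by (intro mult_right_mono out_degree_le sum_nonneg) (simp add: weight_nonneg)
    finally show ?thesis .
  qed
  have "(Laplacian a *v v) \<bullet> (Laplacian a *v v) = (\<Sum>i\<in>UNIV. ((Laplacian a *v v) $ i)\<^sup>2)"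
    by (simp add: inner_vec_def power2_eq_square)
  also have "\<dots> \<le> (\<Sum>i\<in>UNIV. ev CARD('N) * (\<Sum>j\<in>UNIV. a $ i $ j * (v $ i - v $ j)\<^sup>2))"
    by (intro sum_mono row)
  also have "\<dots> = 2 * ev CARD('N) * (v \<bullet> (Laplacian a *v v))"
    unfolding dirichlet_form by (simp flip: sum_distrib_left)
  finally show ?thesis .
qed

end

text \<open>The rank-one correction \<open>(1 \<bullet> v) *\<^sub>R 1\<close> makes the Laplacian
  injective, hence onto, and vanishes at the preimage of a \<open>b\<close> orthogonal to
  \<open>1\<close>. The constants in the kernel leave the sum \<open>c\<close> of the solution
  free.\<close>

lemma Laplacian_surj:
  assumes "1 \<bullet> b = 0"
  obtains v where "Laplacian a *v v = b" "1 \<bullet> v = c"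
proof -
  define F where "F v = Laplacian a *v v + (1 \<bullet> v) *\<^sub>R 1" for v
  have lin: "linear F" unfolding F_def
    by (intro linearI) (simp_all add: matrix_vector_right_distrib matrix_vector_mult_scaleR inner_add_right algebra_simps)
  have one_F: "1 \<bullet> F v = (1 \<bullet> v) * (1 \<bullet> (1 :: real^'N))" for v
    by (simp add: F_def inner_add_right one_Laplacian)
  have one: "1 \<bullet> (1 :: real^'N) \<noteq> 0" by (metis inner_eq_zero_iff zero_neq_one)
  have "inj F" unfolding linear_injective_0[OF lin]
  proof (intro allI impI)
    fix v assume "F v = 0"
    then have "1 \<bullet> v = 0" using one_F[of v] one by simp
    with \<open>F v = 0\<close> have "Laplacian a *v v = 0" by (simp add: F_def)
    with \<open>1 \<bullet> v = 0\<close> show "v = 0" using dirichlet_form_eq_0_imp_0 by simp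
  qed
  then have "surj F" by (rule linear_inj_imp_surj[OF lin])
  then obtain v where v: "F v = b" by (metis surjD)
  then have "1 \<bullet> v = 0" using one_F[of v] one assms by simp
  define u where "u = v + (c / (1 \<bullet> (1 :: real^'N))) *\<^sub>R 1"
  have "Laplacian a *v u = b"
    using v \<open>1 \<bullet> v = 0\<close> by (simp add: u_def F_def matrix_vector_right_distrib matrix_vector_mult_scaleR Laplacian_one)
  moreover have "1 \<bullet> u = c" using \<open>1 \<bullet> v = 0\<close> one by (simp add: u_def inner_add_right)
  ultimately show ?thesis by (rule that)
qed

end

section \<open>The primal-dual iteration\<close>

lemma abs_le_add_if_square_le:
  fixes T u v :: real
  assumes "T\<^sup>2 \<le> 4 * u * v" "0 \<le> u" "0 \<le> v"
  shows "\<bar>T\<bar> \<le> u + v"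
proof -
  have "(u + v)\<^sup>2 - 4 * u * v = (u - v)\<^sup>2" by (simp add: power2_eq_square algebra_simps)
  then have "T\<^sup>2 \<le> (u + v)\<^sup>2" using assms(1) zero_le_power2[of "u - v"] by linarith
  then show ?thesis using assms abs_le_square_iff[of T "u + v"] by simp
qed

lemma inner_three_le: "(x + y + z) \<bullet> (x + y + z) \<le> 3 * (x \<bullet> x + y \<bullet> y + z \<bullet> z)"
proof -
  have "0 \<le> (x - y) \<bullet> (x - y)" "0 \<le> (y - z) \<bullet> (y - z)" "0 \<le> (x - z) \<bullet> (x - z)" by simp_all
  then show ?thesis
    by (simp add: inner_diff_left inner_diff_right inner_add_left inner_add_right inner_commute)
qed

text \<open>Here \<open>m\<close> and \<open>M\<close> are the smallest nonzero and the largest eigenvalue of the symmetrized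
  Laplacian.\<close>

locale gain_conditions =
  fixes \<alpha> \<beta> \<gamma> l lbar m M :: real
  assumes l_pos: "0 < l" and l_le: "l \<le> lbar" and m_pos: "0 < m" and m_le: "m \<le> M"
    and \<alpha>: "1 \<le> \<alpha>" "1 \<le> \<alpha> * l" "2 * lbar\<^sup>2 \<le> \<alpha> * l * m"
    and \<beta>: "4 * \<alpha>\<^sup>2 * M\<^sup>2 \<le> \<beta> * m\<^sup>2"
    and \<gamma>: "0 < \<gamma>" "\<gamma> * (\<beta>^4 * (M\<^sup>2 + lbar\<^sup>2)) < 1"
begin

lemma four_\<alpha>_sq_ratio_le: "4 * \<alpha>\<^sup>2 * M \<le> \<beta> * m"
proof -
  have "4 * \<alpha>\<^sup>2 * M * m \<le> 4 * \<alpha>\<^sup>2 * M * M"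
    using m_pos m_le by (intro mult_left_mono) auto
  with \<beta> have "(4 * \<alpha>\<^sup>2 * M) * m \<le> (\<beta> * m) * m" by (simp add: power2_eq_square mult.assoc)
  then show ?thesis using m_pos by (metis mult_le_cancel_right not_less_iff_gr_or_eq)
qed

lemma four_\<alpha>_sq_le: "4 * \<alpha>\<^sup>2 \<le> \<beta>"
proof -
  have "4 * \<alpha>\<^sup>2 * m \<le> 4 * \<alpha>\<^sup>2 * M" using m_le by (intro mult_left_mono) auto
  then have "4 * \<alpha>\<^sup>2 * m \<le> \<beta> * m" using four_\<alpha>_sq_ratio_le by linarith
  then show ?thesis using m_pos by simp
qed

lemma \<alpha>_le: "\<alpha> \<le> \<alpha>\<^sup>2" using \<alpha>(1) by (simp add: power2_eq_square)

lemma \<beta>_ge_4: "4 \<le> \<beta>" using four_\<alpha>_sq_le \<alpha>_le \<alpha>(1) by linarith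

text \<open>The step size condition is quadratic in \<open>M\<close>, whereas the second-order terms
  are linear in it. This lower bound trades \<open>\<gamma> * \<beta>^4 * M^2 \<le> 1\<close> for
  \<open>\<gamma> * \<beta>^3 * M \<le> 1 / 8\<close>.\<close>

lemma \<beta>_M_ge_8: "8 \<le> \<beta> * M"
proof -
  have "2 * l\<^sup>2 \<le> 2 * lbar\<^sup>2" using l_pos l_le by (simp add: power_mono)
  then have "2 * l * l \<le> \<alpha> * m * l" using \<alpha>(3) by (simp add: power2_eq_square mult_ac)
  then have "2 * l \<le> \<alpha> * m" using l_pos by simp
  then have "2 * (\<alpha> * l) \<le> \<alpha>\<^sup>2 * m"
    using \<alpha>(1) mult_left_mono[of "2 * l" "\<alpha> * m" \<alpha>] by (simp add: power2_eq_square mult_ac)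
  then have "2 \<le> \<alpha>\<^sup>2 * m" using \<alpha>(2) by linarith
  moreover have "\<alpha>\<^sup>2 * m \<le> \<alpha>\<^sup>2 * M" using m_le by (intro mult_left_mono) auto
  moreover have "4 * \<alpha>\<^sup>2 * M \<le> \<beta> * M" using four_\<alpha>_sq_le m_pos m_le by (intro mult_right_mono) auto
  ultimately show ?thesis by linarith
qed

text \<open>The left sides are the coefficients of \<open>e\<close>, \<open>q\<close>,
  \<open>Q\<close> in the second-order part of the Lyapunov difference. The right sides are half of
  what the first-order part leaves of \<open>e\<close>, and all that it leaves of \<open>q\<close>
  and \<open>Q\<close>.\<close>

lemma step_size_bounds:
  "3 * \<gamma> * \<alpha>\<^sup>2 * lbar\<^sup>2 \<le> 1 / 8" "6 * \<gamma> * \<beta>\<^sup>2 * M \<le> \<beta> / 12" "6 * \<gamma> * M \<le> 1 / (12 * \<alpha>\<^sup>2)"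
proof -
  have \<beta>0: "0 < \<beta>" using \<beta>_ge_4 by simp
  have M0: "0 < M" using m_pos m_le by linarith
  have "\<gamma> * \<beta>^4 * M\<^sup>2 + \<gamma> * \<beta>^4 * lbar\<^sup>2 < 1" using \<gamma>(2) by (simp add: algebra_simps)
  moreover have "0 \<le> \<gamma> * \<beta>^4 * M\<^sup>2" "0 \<le> \<gamma> * \<beta>^4 * lbar\<^sup>2" using \<gamma>(1) by simp_all
  ultimately have le: "\<gamma> * \<beta>^4 * lbar\<^sup>2 \<le> 1" "\<gamma> * \<beta>^4 * M\<^sup>2 \<le> 1" by linarith+
  have \<beta>3: "64 \<le> \<beta>^3" using power_mono[OF \<beta>_ge_4, of 3] by simp
  have \<beta>2: "16 \<le> \<beta>\<^sup>2" using power_mono[OF \<beta>_ge_4, of 2] by simp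
  have "24 * \<alpha>\<^sup>2 \<le> \<beta>^4"
  proof -
    have "24 * \<alpha>\<^sup>2 \<le> 6 * \<beta>" using four_\<alpha>_sq_le by simp
    also have "\<dots> \<le> \<beta>^3 * \<beta>" using \<beta>3 \<beta>0 by (intro mult_right_mono) auto
    finally show ?thesis by (simp add: power_Suc2[symmetric] eval_nat_numeral)
  qed
  then have "24 * \<alpha>\<^sup>2 * (\<gamma> * lbar\<^sup>2) \<le> \<beta>^4 * (\<gamma> * lbar\<^sup>2)"
    using \<gamma>(1) by (intro mult_right_mono) auto
  then show "3 * \<gamma> * \<alpha>\<^sup>2 * lbar\<^sup>2 \<le> 1 / 8" using le(1) by (simp add: mult_ac)
  have "\<gamma> * \<beta>^3 * M * 8 \<le> \<gamma> * \<beta>^3 * M * (\<beta> * M)"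
    using \<beta>_M_ge_8 \<gamma>(1) \<beta>0 M0 by (intro mult_left_mono) auto
  also have "\<dots> = \<gamma> * \<beta>^4 * M\<^sup>2" by (simp add: eval_nat_numeral)
  finally have cube: "\<gamma> * \<beta>^3 * M * 8 \<le> 1" using le(2) by linarith
  have "(6 * \<gamma> * \<beta>\<^sup>2 * M) * \<beta> \<le> (\<beta> / 12) * \<beta>"
  proof -
    have "(6 * \<gamma> * \<beta>\<^sup>2 * M) * \<beta> = 6 * (\<gamma> * \<beta>^3 * M)" by (simp add: eval_nat_numeral)
    also have "\<dots> \<le> \<beta>\<^sup>2 / 12" using cube \<beta>2 by linarith
    finally show ?thesis by (simp add: power2_eq_square)
  qed
  then show "6 * \<gamma> * \<beta>\<^sup>2 * M \<le> \<beta> / 12" using \<beta>0 by (metis mult_le_cancel_right_pos)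
  have "\<beta> * (6 * \<gamma> * M) * 16 \<le> \<beta> * (6 * \<gamma> * M) * \<beta>\<^sup>2"
    using \<beta>2 \<gamma>(1) \<beta>0 M0 by (intro mult_left_mono) auto
  also have "\<dots> = 6 * (\<gamma> * \<beta>^3 * M)" by (simp add: eval_nat_numeral)
  finally have "\<beta> * (6 * \<gamma> * M) \<le> 1 / 3" using cube by linarith
  moreover have "4 * \<alpha>\<^sup>2 * (6 * \<gamma> * M) \<le> \<beta> * (6 * \<gamma> * M)"
    using four_\<alpha>_sq_le \<gamma>(1) M0 by (intro mult_right_mono) auto
  ultimately have "12 * \<alpha>\<^sup>2 * (6 * \<gamma> * M) \<le> 1" by linarith
  then show "6 * \<gamma> * M \<le> 1 / (12 * \<alpha>\<^sup>2)" using \<alpha>(1) by (simp add: field_simps)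
qed

text \<open>Scalar core of \<open>primal_converges\<close>. In its notation \<open>e\<close>,
  \<open>q\<close>, \<open>Q\<close> are \<open>|e|^2\<close>, \<open>e \<bullet> L e\<close>,
  \<open>s \<bullet> L s\<close>; \<open>eh\<close> is \<open>e \<bullet> h\<close>;
  \<open>T1\<close>, \<open>T2\<close>, \<open>T3\<close> are \<open>e \<bullet> L s\<close>,
  \<open>s \<bullet> L e\<close>, \<open>s \<bullet> h\<close>; and \<open>gg\<close>,
  \<open>rr\<close> are the squared norms of the update directions.\<close>

lemma lyapunov_difference_le:
  fixes e q Q :: real
  assumes nonneg: "0 \<le> e" "0 \<le> q" "0 \<le> Q"
    and convex: "l * e \<le> eh"
    and T1: "m * T1\<^sup>2 \<le> 2 * M * q * Q" and T2: "m * T2\<^sup>2 \<le> 2 * M * q * Q"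
    and T3: "m * T3\<^sup>2 \<le> lbar\<^sup>2 * e * Q"
    and gg: "gg \<le> 3 * (\<alpha>\<^sup>2 * lbar\<^sup>2 * e + 2 * \<beta>\<^sup>2 * M * q + 2 * M * Q)"
    and rr: "rr \<le> 3 * (\<alpha>^4 * lbar\<^sup>2 * e + 2 * \<alpha>\<^sup>2 * M * Q + 2 * \<alpha>^4 * M * q)"
  shows "- 2 * \<gamma> * (\<alpha> * eh + (\<beta> - \<alpha>) * q + T1 + (\<alpha>\<^sup>2 * T3 + \<alpha> * Q - \<alpha>\<^sup>2 * T2) / \<alpha>^3)
      + \<gamma>\<^sup>2 * (gg + rr / \<alpha>^3) \<le> - (\<gamma> / 4) * e"
proof -
  have \<alpha>0: "0 < \<alpha>" and \<beta>0: "0 < \<beta>" and M0: "0 < M" using \<alpha>(1) \<beta>_ge_4 m_pos m_le by linarith+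
  define Q' where "Q' = Q / \<alpha>\<^sup>2"
  have Q': "Q = \<alpha>\<^sup>2 * Q'" "0 \<le> Q'" using \<alpha>0 nonneg by (simp_all add: Q'_def)
  \<comment> \<open>The budget is \<open>\<alpha> * l * e\<close>,
    \<open>3 / 4 * \<beta> * q\<close> and \<open>Q'\<close>. \<open>T1\<close> and
    \<open>T2\<close> take \<open>\<beta> * q / 3\<close> and \<open>3 / 8 * Q'\<close> each,
    \<open>T3 / \<alpha>\<close> takes three quarters of the first and \<open>Q' / 6\<close>; shares
    of 1/4, \<open>\<beta> / 12\<close> and 1/12 remain.\<close>
  have cross: "\<bar>T\<bar> \<le> \<beta> * q / 3 + 3 / 8 * Q'" if T: "m * T\<^sup>2 \<le> 2 * M * q * Q" for T
  proof (rule abs_le_add_if_square_le)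
    have "m * T\<^sup>2 \<le> (4 * \<alpha>\<^sup>2 * M) * (q * Q' / 2)" using T by (simp add: Q'(1) mult_ac)
    also have "\<dots> \<le> (\<beta> * m) * (q * Q' / 2)"
      using four_\<alpha>_sq_ratio_le nonneg Q' by (intro mult_right_mono) auto
    finally have "m * T\<^sup>2 \<le> m * (4 * (\<beta> * q / 3) * (3 / 8 * Q'))" by (simp add: mult_ac)
    then show "T\<^sup>2 \<le> 4 * (\<beta> * q / 3) * (3 / 8 * Q')" using m_pos by (metis mult_le_cancel_left_pos)
  qed (use \<beta>0 nonneg Q' in auto)
  have "\<bar>T3 / \<alpha>\<bar> \<le> 3 / 4 * (\<alpha> * l * e) + Q' / 6"
  proof (rule abs_le_add_if_square_le)
    have "m * (2 * T3\<^sup>2) \<le> (2 * lbar\<^sup>2) * (e * Q)" using T3 by (simp add: mult_ac)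
    also have "\<dots> \<le> (\<alpha> * l * m) * (e * Q)" using \<alpha>(3) nonneg by (intro mult_right_mono) auto
    finally have "m * (2 * T3\<^sup>2) \<le> m * (\<alpha> * l * e * Q)" by (simp add: mult_ac)
    then have "2 * T3\<^sup>2 \<le> \<alpha> * l * e * Q" using m_pos by (metis mult_le_cancel_left_pos)
    then show "(T3 / \<alpha>)\<^sup>2 \<le> 4 * (3 / 4 * (\<alpha> * l * e)) * (Q' / 6)"
      using \<alpha>0 by (simp add: Q'_def power_divide divide_simps mult_ac)
  qed (use \<alpha>0 l_pos nonneg Q' in auto)
  moreover have "\<bar>T2 / \<alpha>\<bar> \<le> \<bar>T2\<bar>" using \<alpha>(1) by (simp add: abs_divide divide_le_eq mult_le_cancel_left1)
  moreover have "\<alpha> * l * e \<le> \<alpha> * eh" using convex \<alpha>0 by (simp add: mult.assoc)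
  moreover have "3 / 4 * \<beta> * q \<le> (\<beta> - \<alpha>) * q"
    using four_\<alpha>_sq_le \<alpha>_le nonneg by (intro mult_right_mono) auto
  moreover have "e \<le> \<alpha> * l * e" using \<alpha>(2) nonneg mult_right_mono[of 1 "\<alpha> * l" e] by simp
  ultimately have first: "e / 4 + \<beta> * q / 12 + Q' / 12
      \<le> \<alpha> * eh + (\<beta> - \<alpha>) * q + T1 + (T3 / \<alpha> + Q' - T2 / \<alpha>)"
    using cross[OF T1] cross[OF T2] by linarith
  \<comment> \<open>As \<open>\<alpha> \<ge> 1\<close> and \<open>\<alpha> \<le> \<beta>^2\<close>,
    the weighted dual term obeys the same bound as \<open>gg\<close>, so both are treated at
    once.\<close>
  have "rr / \<alpha>^3 \<le> 3 * (\<alpha>\<^sup>2 * lbar\<^sup>2 * e + 2 * \<beta>\<^sup>2 * M * q + 2 * M * Q)"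
  proof -
    have "\<alpha>^4 * lbar\<^sup>2 * e \<le> \<alpha>^5 * (lbar\<^sup>2 * e)"
      using \<alpha>(1) nonneg unfolding mult.assoc by (intro mult_right_mono power_increasing) auto
    moreover have "\<alpha>\<^sup>2 * (M * Q) \<le> \<alpha>^3 * (M * Q)"
      using \<alpha>(1) nonneg M0 by (intro mult_right_mono power_increasing) auto
    moreover have "\<alpha>^4 * (M * q) \<le> (\<alpha>^3 * \<beta>\<^sup>2) * (M * q)"
    proof -
      have "\<alpha>^3 * \<alpha> \<le> \<alpha>^3 * \<beta>\<^sup>2"
      proof (intro mult_left_mono)
        have "\<alpha> \<le> \<beta>" using \<alpha>_le four_\<alpha>_sq_le \<alpha>0 by simp
        also have "\<beta> \<le> \<beta>\<^sup>2" using \<beta>_ge_4 by (intro self_le_power) auto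
        finally show "\<alpha> \<le> \<beta>\<^sup>2" .
      qed (use \<alpha>0 in simp)
      then show ?thesis using nonneg M0 by (intro mult_right_mono) (auto simp: eval_nat_numeral)
    qed
    ultimately have "rr \<le> 3 * (\<alpha>^5 * (lbar\<^sup>2 * e) + 2 * (\<alpha>^3 * (M * Q)) + 2 * ((\<alpha>^3 * \<beta>\<^sup>2) * (M * q)))"
      using rr by (simp add: mult.assoc)
    also have "\<dots> = 3 * (\<alpha>\<^sup>2 * lbar\<^sup>2 * e + 2 * \<beta>\<^sup>2 * M * q + 2 * M * Q) * \<alpha>^3"
      by (simp add: eval_nat_numeral algebra_simps)
    finally show ?thesis using \<alpha>0 by (simp add: pos_divide_le_eq)
  qed
  with gg have "\<gamma> / 2 * (gg + rr / \<alpha>^3)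
      \<le> \<gamma> / 2 * (6 * (\<alpha>\<^sup>2 * lbar\<^sup>2 * e + 2 * \<beta>\<^sup>2 * M * q + 2 * M * Q))"
    using \<gamma>(1) by (intro mult_left_mono) auto
  also have "\<dots> = (3 * \<gamma> * \<alpha>\<^sup>2 * lbar\<^sup>2) * e + (6 * \<gamma> * \<beta>\<^sup>2 * M) * q + (6 * \<gamma> * M) * Q"
    by (simp add: algebra_simps)
  also have "\<dots> \<le> (1 / 8) * e + (\<beta> / 12) * q + (1 / (12 * \<alpha>\<^sup>2)) * Q"
    using step_size_bounds nonneg by (intro add_mono mult_right_mono)
  finally have second: "\<gamma> / 2 * (gg + rr / \<alpha>^3) \<le> e / 8 + \<beta> * q / 12 + Q' / 12"
    by (simp add: Q'_def)
  have eq: "(\<alpha>\<^sup>2 * T3 + \<alpha> * Q - \<alpha>\<^sup>2 * T2) / \<alpha>^3 = T3 / \<alpha> + Q' - T2 / \<alpha>"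
    using \<alpha>0 by (simp add: Q'_def eval_nat_numeral divide_simps) (simp add: algebra_simps)
  have "e / 8 \<le> (\<alpha> * eh + (\<beta> - \<alpha>) * q + T1 + (\<alpha>\<^sup>2 * T3 + \<alpha> * Q - \<alpha>\<^sup>2 * T2) / \<alpha>^3)
      - \<gamma> / 2 * (gg + rr / \<alpha>^3)" (is "_ \<le> ?d")
    unfolding eq using first second by linarith
  then have "2 * \<gamma> * (e / 8) \<le> 2 * \<gamma> * ?d" using \<gamma>(1) by (intro mult_left_mono) auto
  moreover have "- 2 * \<gamma> * D + \<gamma>\<^sup>2 * Y \<le> - (\<gamma> / 4) * e"
    if "2 * \<gamma> * (e / 8) \<le> 2 * \<gamma> * (D - \<gamma> / 2 * Y)" for D Y
    using that by (simp add: power2_eq_square algebra_simps)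
  ultimately show ?thesis by blast
qed

end

section \<open>Convergence of the primal-dual iteration in vector form\<close>

locale primal_dual = balanced_digraph a + gain_conditions \<alpha> \<beta> \<gamma> l lbar "ev 2" "ev CARD('N)"
  for a :: "real^'N::finite^'N" and ev :: "nat \<Rightarrow> real" and \<alpha> \<beta> \<gamma> l lbar :: real +
  fixes G :: "real^'N \<Rightarrow> real^'N" and z \<Lambda> :: "nat \<Rightarrow> real^'N" and ystar :: real
  assumes card: "CARD('N) \<ge> 2" and ev: "ordered_eigenvalues (Sym (Laplacian a)) ev"
    and monotone: "\<And>u v. l * ((u - v) \<bullet> (u - v)) \<le> (u - v) \<bullet> (G u - G v)"
    and Lipschitz: "\<And>u v. (G u - G v) \<bullet> (G u - G v) \<le> lbar\<^sup>2 * ((u - v) \<bullet> (u - v))"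
    and optimal: "1 \<bullet> G (ystar *\<^sub>R 1) = 0"
    and z_step: "\<And>t. z (Suc t) = z t - \<gamma> *\<^sub>R (\<alpha> *\<^sub>R G (z t) + \<beta> *\<^sub>R (Laplacian a *v z t) + Laplacian a *v \<Lambda> t)"
    and \<Lambda>_step: "\<And>t. \<Lambda> (Suc t) = \<Lambda> t + (\<gamma> * \<alpha> * \<beta>) *\<^sub>R (Laplacian a *v z t)"
begin

text \<open>The orthogonal projection onto the complement of the constants, where the quadratic form
  of the Laplacian is at least \<open>ev 2\<close> times the squared norm.\<close>

definition centered :: "real^'N \<Rightarrow> real^'N" where
  "centered v = v - ((1 \<bullet> v) / (1 \<bullet> (1 :: real^'N))) *\<^sub>R 1"

lemma one_neq_0: "1 \<bullet> (1 :: real^'N) \<noteq> 0"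
  by (metis inner_eq_zero_iff zero_neq_one)

lemma linear_centered: "linear centered"
  unfolding centered_def by (intro linearI) (simp_all add: inner_add_right add_divide_distrib algebra_simps)

lemma one_centered [simp]: "1 \<bullet> centered v = 0"
  by (simp add: centered_def inner_diff_right one_neq_0)

lemma centered_eq: "centered v = v" if "1 \<bullet> v = 0"
  using that by (simp add: centered_def)

lemma Laplacian_centered [simp]: "Laplacian a *v centered v = Laplacian a *v v"
  by (simp add: centered_def matrix_vector_mult_diff_distrib matrix_vector_mult_scaleR Laplacian_one)

lemma dot_centered: "u \<bullet> centered v = u \<bullet> v" if "1 \<bullet> u = 0"
  using that by (simp add: centered_def inner_diff_right inner_commute[of u 1])

lemma centered_dot: "centered v \<bullet> u = v \<bullet> u" if "1 \<bullet> u = 0"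
  using dot_centered[OF that] by (simp add: inner_commute)

lemma centered_dot_self_le: "centered v \<bullet> centered v \<le> v \<bullet> v"
proof -
  have "centered v \<bullet> centered v = v \<bullet> v - (1 \<bullet> v)\<^sup>2 / (1 \<bullet> (1 :: real^'N))"
    using dot_centered[of "centered v" v] one_centered
    by (simp add: centered_def inner_diff_left power2_eq_square)
  then show ?thesis by simp
qed

text \<open>Stands in for the Cauchy-Schwarz inequality of a symmetric form: the ordinary one is
  applied to \<open>u\<close> and \<open>L v\<close>, and both norms are turned back into the
  quadratic form. The eigenvalue ratio is the price.\<close>

lemma Laplacian_dot_sq_le:
  assumes "1 \<bullet> u = 0"
  shows "ev 2 * (u \<bullet> (Laplacian a *v v))\<^sup>2
    \<le> 2 * ev CARD('N) * (u \<bullet> (Laplacian a *v u)) * (v \<bullet> (Laplacian a *v v))"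
proof -
  have "ev 2 * (u \<bullet> (Laplacian a *v v))\<^sup>2
      \<le> (ev 2 * (u \<bullet> u)) * ((Laplacian a *v v) \<bullet> (Laplacian a *v v))"
    using Cauchy_Schwarz_ineq[of u "Laplacian a *v v"] m_pos by (simp add: mult.assoc)
  also have "\<dots> \<le> (u \<bullet> (Laplacian a *v u)) * (2 * ev CARD('N) * (v \<bullet> (Laplacian a *v v)))"
    using dirichlet_form_ge[OF ev card assms] Laplacian_dot_le[OF ev card]
    by (intro mult_mono) (simp_all add: dirichlet_form_nonneg)
  finally show ?thesis by (simp add: mult_ac)
qed

text \<open>Optimality makes the right side orthogonal to \<open>1\<close>, hence solvable. Dual
  equilibria form a line along \<open>1\<close>; as \<open>1 \<bullet> \<Lambda> t\<close> is
  conserved, the point with the same sum keeps the dual deviation orthogonal to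
  \<open>1\<close>.\<close>

lemma equilibrium_exists:
  obtains \<Lambda>s where "Laplacian a *v \<Lambda>s = - (\<alpha> *\<^sub>R G (ystar *\<^sub>R 1))" "\<And>t. 1 \<bullet> (\<Lambda> t - \<Lambda>s) = 0"
proof -
  have sum_\<Lambda>: "1 \<bullet> \<Lambda> t = 1 \<bullet> \<Lambda> 0" for t
    by (induction t) (simp_all add: \<Lambda>_step inner_add_right one_Laplacian)
  have "1 \<bullet> (- (\<alpha> *\<^sub>R G (ystar *\<^sub>R 1))) = 0" using optimal by simp
  then obtain v where "Laplacian a *v v = - (\<alpha> *\<^sub>R G (ystar *\<^sub>R 1))" "1 \<bullet> v = 1 \<bullet> \<Lambda> 0"
    by (rule Laplacian_surj)
  with sum_\<Lambda> that show ?thesis by (simp add: inner_diff_right)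
qed

text \<open>With \<open>e\<close> and \<open>\<eta>\<close> the deviations of \<open>z\<close> and \<open>\<Lambda>\<close> from the equilibrium, the combination
  \<open>s = \<alpha> e + \<eta>\<close> (centered) cancels \<open>\<beta>\<close> from the dual dynamics, so that \<open>s\<close> decays by itself up to a
  perturbation by \<open>e\<close> independent of \<open>\<beta>\<close>; the Lyapunov function is \<open>|e|\<^sup>2 + |s|\<^sup>2 / \<alpha>\<^sup>3\<close>.\<close>

lemma primal_converges: "z \<longlonglongrightarrow> ystar *\<^sub>R 1" and dual_bounded: "bounded (range \<Lambda>)"
proof -
  obtain \<Lambda>s where \<Lambda>s: "Laplacian a *v \<Lambda>s = - (\<alpha> *\<^sub>R G (ystar *\<^sub>R 1))" "\<And>t. 1 \<bullet> (\<Lambda> t - \<Lambda>s) = 0"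
    using equilibrium_exists by blast
  have \<alpha>0: "0 < \<alpha>" using \<alpha>(1) by simp
  define L where "L = Laplacian a"
  define e where "e t = z t - ystar *\<^sub>R 1" for t
  define \<eta> where "\<eta> t = \<Lambda> t - \<Lambda>s" for t
  define s where "s t = \<alpha> *\<^sub>R centered (e t) + \<eta> t" for t
  define h where "h t = G (z t) - G (ystar *\<^sub>R 1)" for t
  define g where "g t = \<alpha> *\<^sub>R h t + (\<beta> - \<alpha>) *\<^sub>R (L *v e t) + L *v s t" for t
  define r where "r t = \<alpha>\<^sup>2 *\<^sub>R centered (h t) + \<alpha> *\<^sub>R (L *v s t) + (- (\<alpha>\<^sup>2)) *\<^sub>R (L *v e t)" for t
  \<comment> \<open>The weight turns the coupling \<open>\<alpha>\<^sup>2 * (s \<bullet> h)\<close>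
    into \<open>s \<bullet> h / \<alpha>\<close> and the dissipation \<open>\<alpha> * Q\<close>
    into \<open>Q / \<alpha>\<^sup>2\<close>, the scale at which
    \<open>2 * lbar\<^sup>2 \<le> \<alpha> * l * m\<close> absorbs the coupling.\<close>
  define V where "V t = e t \<bullet> e t + (s t \<bullet> s t) / \<alpha>^3" for t
  have one_s: "1 \<bullet> s t = 0" for t
    using \<Lambda>s(2) by (simp add: s_def \<eta>_def inner_add_right)
  have Ls: "L *v s t = \<alpha> *\<^sub>R (L *v e t) + L *v \<eta> t" for t
    by (simp add: s_def L_def matrix_vector_right_distrib matrix_vector_mult_scaleR)
  have L_e: "L *v e t = L *v z t" for t
    by (simp add: e_def L_def matrix_vector_mult_diff_distrib matrix_vector_mult_scaleR Laplacian_one)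
  have L_\<eta>: "L *v \<eta> t = L *v \<Lambda> t + \<alpha> *\<^sub>R G (ystar *\<^sub>R 1)" for t
    using \<Lambda>s(1) by (simp add: \<eta>_def L_def matrix_vector_mult_diff_distrib)
  have e_step: "e (Suc t) = e t - \<gamma> *\<^sub>R g t" for t
    unfolding g_def Ls L_\<eta> L_e h_def
    by (simp add: e_def z_step algebra_simps flip: L_def)
  have \<eta>_step: "\<eta> (Suc t) = \<eta> t + (\<gamma> * \<alpha> * \<beta>) *\<^sub>R (L *v e t)" for t
    unfolding L_e by (simp add: \<eta>_def \<Lambda>_step L_def)
  have centered_L: "centered (L *v v) = L *v v" for v
    by (simp add: L_def centered_eq one_Laplacian)
  have s_step: "s (Suc t) = s t - \<gamma> *\<^sub>R r t" for t
  proof -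
    have c: "centered (e (Suc t)) = centered (e t)
        - \<gamma> *\<^sub>R (\<alpha> *\<^sub>R centered (h t) + (\<beta> - \<alpha>) *\<^sub>R (L *v e t) + L *v s t)"
      unfolding e_step g_def
      by (simp add: linear_diff[OF linear_centered] linear_add[OF linear_centered] linear_scale[OF linear_centered] centered_L)
    show ?thesis
      by (simp add: s_def[of "Suc t"] s_def[of t] c \<eta>_step r_def power2_eq_square algebra_simps)
  qed
  have one_L: "1 \<bullet> (L *v v) = 0" for v by (simp add: L_def one_Laplacian)
  have descent: "V (Suc t) \<le> V t - (\<gamma> / 4) * (e t \<bullet> e t)" for t
  proof -
    define q where "q = e t \<bullet> (L *v e t)"
    define Q where "Q = s t \<bullet> (L *v s t)"
    have nonneg: "0 \<le> q" "0 \<le> Q" by (simp_all add: q_def Q_def L_def dirichlet_form_nonneg)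
    have hh: "h t \<bullet> h t \<le> lbar\<^sup>2 * (e t \<bullet> e t)"
      using Lipschitz[of "z t" "ystar *\<^sub>R 1"] by (simp add: h_def e_def)
    have Lq: "(L *v e t) \<bullet> (L *v e t) \<le> 2 * ev CARD('N) * q"
      and LQ: "(L *v s t) \<bullet> (L *v s t) \<le> 2 * ev CARD('N) * Q"
      unfolding L_def q_def Q_def by (rule Laplacian_dot_le[OF ev card])+
    have "- 2 * \<gamma> * (\<alpha> * (e t \<bullet> h t) + (\<beta> - \<alpha>) * q + e t \<bullet> (L *v s t)
          + (\<alpha>\<^sup>2 * (s t \<bullet> h t) + \<alpha> * Q - \<alpha>\<^sup>2 * (s t \<bullet> (L *v e t))) / \<alpha>^3)
        + \<gamma>\<^sup>2 * (g t \<bullet> g t + (r t \<bullet> r t) / \<alpha>^3) \<le> - (\<gamma> / 4) * (e t \<bullet> e t)"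
    proof (rule lyapunov_difference_le)
      show "l * (e t \<bullet> e t) \<le> e t \<bullet> h t"
        using monotone[of "z t" "ystar *\<^sub>R 1"] by (simp add: h_def e_def)
      show "ev 2 * (e t \<bullet> (L *v s t))\<^sup>2 \<le> 2 * ev CARD('N) * q * Q"
        \<comment> \<open>The bound needs a first argument orthogonal to \<open>1\<close>; centering
          \<open>e t\<close> changes neither of the products.\<close>
        using Laplacian_dot_sq_le[of "centered (e t)" "s t"] centered_dot one_Laplacian
        by (simp add: L_def q_def Q_def)
      show "ev 2 * (s t \<bullet> (L *v e t))\<^sup>2 \<le> 2 * ev CARD('N) * q * Q"
        using Laplacian_dot_sq_le[of "s t" "e t", OF one_s]
        by (simp add: L_def q_def Q_def mult_ac)
      show "ev 2 * (s t \<bullet> h t)\<^sup>2 \<le> lbar\<^sup>2 * (e t \<bullet> e t) * Q"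
      proof -
        have "ev 2 * (s t \<bullet> h t)\<^sup>2 \<le> (ev 2 * (s t \<bullet> s t)) * (h t \<bullet> h t)"
          using Cauchy_Schwarz_ineq[of "s t" "h t"] m_pos by (simp add: mult.assoc)
        also have "\<dots> \<le> Q * (lbar\<^sup>2 * (e t \<bullet> e t))"
          using dirichlet_form_ge[OF ev card one_s] hh nonneg
          by (intro mult_mono) (simp_all add: Q_def L_def)
        finally show ?thesis by (simp add: mult_ac)
      qed
      have "g t \<bullet> g t \<le> 3 * (\<alpha>\<^sup>2 * (h t \<bullet> h t) + (\<beta> - \<alpha>)\<^sup>2 * ((L *v e t) \<bullet> (L *v e t)) + (L *v s t) \<bullet> (L *v s t))"
        using inner_three_le[of "\<alpha> *\<^sub>R h t" "(\<beta> - \<alpha>) *\<^sub>R (L *v e t)" "L *v s t"]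
        by (simp add: g_def power2_eq_square mult.assoc)
      also have "\<dots> \<le> 3 * (\<alpha>\<^sup>2 * (lbar\<^sup>2 * (e t \<bullet> e t)) + \<beta>\<^sup>2 * (2 * ev CARD('N) * q) + 2 * ev CARD('N) * Q)"
      proof -
        have "(\<beta> - \<alpha>)\<^sup>2 \<le> \<beta>\<^sup>2" using \<alpha>0 \<alpha>_le four_\<alpha>_sq_le by (intro power_mono) auto
        then show ?thesis
          using hh Lq LQ by (intro mult_left_mono add_mono mult_mono) auto
      qed
      finally show "g t \<bullet> g t \<le> 3 * (\<alpha>\<^sup>2 * lbar\<^sup>2 * (e t \<bullet> e t) + 2 * \<beta>\<^sup>2 * ev CARD('N) * q + 2 * ev CARD('N) * Q)"
        by (simp add: mult_ac)
      have "r t \<bullet> r t \<le> 3 * (\<alpha>^4 * (centered (h t) \<bullet> centered (h t)) + \<alpha>\<^sup>2 * ((L *v s t) \<bullet> (L *v s t)) + \<alpha>^4 * ((L *v e t) \<bullet> (L *v e t)))"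
        using inner_three_le[of "\<alpha>\<^sup>2 *\<^sub>R centered (h t)" "\<alpha> *\<^sub>R (L *v s t)" "(- (\<alpha>\<^sup>2)) *\<^sub>R (L *v e t)"]
        by (simp add: r_def eval_nat_numeral mult.assoc)
      also have "\<dots> \<le> 3 * (\<alpha>^4 * (lbar\<^sup>2 * (e t \<bullet> e t)) + \<alpha>\<^sup>2 * (2 * ev CARD('N) * Q) + \<alpha>^4 * (2 * ev CARD('N) * q))"
        using order_trans[OF centered_dot_self_le hh] Lq LQ by (intro mult_left_mono add_mono) auto
      finally show "r t \<bullet> r t \<le> 3 * (\<alpha>^4 * lbar\<^sup>2 * (e t \<bullet> e t) + 2 * \<alpha>\<^sup>2 * ev CARD('N) * Q + 2 * \<alpha>^4 * ev CARD('N) * q)"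
        by (simp add: mult_ac)
    qed (use nonneg in auto)
    moreover have "e t \<bullet> g t = \<alpha> * (e t \<bullet> h t) + (\<beta> - \<alpha>) * q + e t \<bullet> (L *v s t)"
      by (simp add: g_def q_def inner_add_right)
    moreover have "s t \<bullet> r t = \<alpha>\<^sup>2 * (s t \<bullet> h t) + \<alpha> * Q - \<alpha>\<^sup>2 * (s t \<bullet> (L *v e t))"
      by (simp add: r_def Q_def inner_add_right inner_diff_right dot_centered[OF one_s])
    ultimately have "- 2 * \<gamma> * (e t \<bullet> g t + (s t \<bullet> r t) / \<alpha>^3) + \<gamma>\<^sup>2 * (g t \<bullet> g t + (r t \<bullet> r t) / \<alpha>^3)
        \<le> - (\<gamma> / 4) * (e t \<bullet> e t)"
      by simp
    moreover have sq: "(v - \<gamma> *\<^sub>R u) \<bullet> (v - \<gamma> *\<^sub>R u) = v \<bullet> v - 2 * \<gamma> * (v \<bullet> u) + \<gamma>\<^sup>2 * (u \<bullet> u)" for u v :: "real^'N"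
      by (simp add: inner_diff_left inner_diff_right inner_commute[of u v] power2_eq_square algebra_simps)
    have "V (Suc t) = V t + (- 2 * \<gamma> * (e t \<bullet> g t + (s t \<bullet> r t) / \<alpha>^3)
        + \<gamma>\<^sup>2 * (g t \<bullet> g t + (r t \<bullet> r t) / \<alpha>^3))"
      unfolding V_def e_step s_step sq by (simp add: add_divide_distrib diff_divide_distrib algebra_simps)
    ultimately show ?thesis by linarith
  qed
  have V_nonneg: "0 \<le> V t" for t using \<alpha>0 by (simp add: V_def)
  have "V (Suc t) \<le> V t" for t
    using descent[of t] \<gamma>(1) by (smt (verit) inner_ge_zero mult_nonneg_nonneg divide_nonneg_pos)
  then have "decseq V" by (rule decseq_SucI)
  with V_nonneg obtain v where v: "V \<longlonglongrightarrow> v" using decseq_convergent by metis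
  \<comment> \<open>\<open>V\<close> converges, so its decrements vanish, and by
    \<open>descent\<close> they dominate \<open>|e|^2\<close>.\<close>
  have "(\<lambda>t. 4 / \<gamma> * (V t - V (Suc t))) \<longlonglongrightarrow> 4 / \<gamma> * (v - v)"
    by (intro tendsto_intros v LIMSEQ_Suc)
  then have lim: "(\<lambda>t. 4 / \<gamma> * (V t - V (Suc t))) \<longlonglongrightarrow> 0" by simp
  have "norm (e t \<bullet> e t) \<le> 4 / \<gamma> * (V t - V (Suc t))" for t
    using descent[of t] \<gamma>(1) by (simp add: field_simps)
  then have "(\<lambda>t. e t \<bullet> e t) \<longlonglongrightarrow> 0"
    by (intro Lim_null_comparison[OF eventuallyI lim])
  then have "(\<lambda>t. sqrt (e t \<bullet> e t)) \<longlonglongrightarrow> sqrt 0" by (intro tendsto_real_sqrt)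
  then have e0: "e \<longlonglongrightarrow> 0" by (simp add: norm_eq_sqrt_inner[symmetric] tendsto_norm_zero_iff)
  then show "z \<longlonglongrightarrow> ystar *\<^sub>R 1" unfolding e_def by (simp add: LIM_zero_iff)
  \<comment> \<open>The descent bound contains no \<open>s\<close>, so the dual part is only
    bounded, by \<open>V t \<le> V 0\<close>; \<open>\<Lambda>\<close> is then recovered from
    \<open>s\<close> and \<open>e\<close>.\<close>
  have s_le: "norm (s t) \<le> sqrt (\<alpha>^3 * V 0)" for t
  proof -
    have "V t \<le> V 0" using \<open>decseq V\<close> by (simp add: decseq_def)
    moreover have "(s t \<bullet> s t) / \<alpha>^3 \<le> V t" by (simp add: V_def)
    ultimately have "(s t \<bullet> s t) / \<alpha>^3 \<le> V 0" by linarith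
    then have "s t \<bullet> s t \<le> \<alpha>^3 * V 0" using \<alpha>0 by (simp add: pos_divide_le_eq mult.commute)
    then show ?thesis unfolding norm_eq_sqrt_inner by (rule real_sqrt_le_mono)
  qed
  have "bounded (range s)" using s_le by (auto simp: bounded_iff)
  moreover have "bounded (range (\<lambda>t. \<alpha> *\<^sub>R centered (e t)))"
  proof -
    have "linear (\<lambda>v. \<alpha> *\<^sub>R centered v)" by (intro linear_compose_scale_right linear_centered)
    then have "bounded ((\<lambda>v. \<alpha> *\<^sub>R centered v) ` range e)"
      using convergent_imp_bounded[OF e0] by (intro bounded_linear_image) (simp_all add: linear_conv_bounded_linear)
    then show ?thesis by (simp add: image_image)
  qed
  ultimately have "bounded (range (\<lambda>t. s t - \<alpha> *\<^sub>R centered (e t)))" by (intro bounded_minus_comp)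
  then have "bounded (range (\<lambda>t. (s t - \<alpha> *\<^sub>R centered (e t)) + \<Lambda>s))" by (intro bounded_plus_comp) auto
  then show "bounded (range \<Lambda>)" by (simp add: s_def \<eta>_def)
qed

end

section \<open>Minimizers of strongly convex functions\<close>

lemma strongly_convex_has_derivative:
  "(f has_real_derivative deriv f s) (at s)" if "strongly_convex \<omega> f"
  using that by (simp add: strongly_convex_def DERIV_deriv_iff_real_differentiable)

lemma deriv_sum_strongly_convex:
  assumes "\<And>i. i \<in> I \<Longrightarrow> strongly_convex \<omega> (f i)"
  shows "((\<lambda>s. \<Sum>i\<in>I. f i s) has_real_derivative (\<Sum>i\<in>I. deriv (f i) s)) (at s)"
  using assms by (intro DERIV_sum strongly_convex_has_derivative)

lemma strongly_convex_sum:
  assumes "finite I" "I \<noteq> {}" and f: "\<And>i. i \<in> I \<Longrightarrow> strongly_convex \<omega> (f i)"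
  shows "strongly_convex \<omega> (\<lambda>s. \<Sum>i\<in>I. f i s)"
  unfolding strongly_convex_def
proof (intro conjI allI)
  from assms show "0 < \<omega>" by (auto simp: strongly_convex_def)
  show "(\<lambda>s. \<Sum>i\<in>I. f i s) differentiable at s" for s
    using deriv_sum_strongly_convex[of I \<omega> f s] f by (auto simp: real_differentiable_def)
  fix s1 s2
  have deriv: "deriv (\<lambda>s. \<Sum>i\<in>I. f i s) s = (\<Sum>i\<in>I. deriv (f i) s)" for s
    using f by (intro DERIV_imp_deriv deriv_sum_strongly_convex)
  obtain i where i: "i \<in> I" using assms(2) by blast
  have "\<omega> * \<bar>s1 - s2\<bar>\<^sup>2 \<le> (deriv (f i) s1 - deriv (f i) s2) * (s1 - s2)"
    using f[OF i] by (simp add: strongly_convex_def)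
  also have "\<dots> \<le> (\<Sum>i\<in>I. (deriv (f i) s1 - deriv (f i) s2) * (s1 - s2))"
  proof (rule member_le_sum[OF i])
    fix j assume "j \<in> I - {i}"
    then have "\<omega> * \<bar>s1 - s2\<bar>\<^sup>2 \<le> (deriv (f j) s1 - deriv (f j) s2) * (s1 - s2)" "0 < \<omega>"
      using f[of j] by (simp_all add: strongly_convex_def)
    moreover from \<open>0 < \<omega>\<close> have "0 \<le> \<omega> * \<bar>s1 - s2\<bar>\<^sup>2" by simp
    ultimately show "0 \<le> (deriv (f j) s1 - deriv (f j) s2) * (s1 - s2)" by linarith
  qed (fact assms(1))
  also have "\<dots> = (deriv (\<lambda>s. \<Sum>i\<in>I. f i s) s1 - deriv (\<lambda>s. \<Sum>i\<in>I. f i s) s2) * (s1 - s2)"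
    unfolding deriv by (simp add: sum_subtractf flip: sum_distrib_right)
  finally show "\<omega> * \<bar>s1 - s2\<bar>\<^sup>2 \<le> (deriv (\<lambda>s. \<Sum>i\<in>I. f i s) s1 - deriv (\<lambda>s. \<Sum>i\<in>I. f i s) s2) * (s1 - s2)" .
qed

text \<open>\<open>ARG_MIN\<close> is a choice operator, so a minimizer has to be exhibited before
  anything is known about the chosen point.\<close>

lemma deriv_arg_min_strongly_convex:
  assumes F: "strongly_convex \<omega> F" and cont: "continuous_on UNIV (deriv F)"
  shows "deriv F (ARG_MIN F s. True) = 0"
proof -
  have \<omega>: "0 < \<omega>" and strong: "\<And>s1 s2. \<omega> * \<bar>s1 - s2\<bar>\<^sup>2 \<le> (deriv F s1 - deriv F s2) * (s1 - s2)"
    using F by (auto simp: strongly_convex_def)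
  \<comment> \<open>At distance \<open>b\<close> from 0, strong monotonicity has moved the
    derivative by at least \<open>|deriv F 0|\<close>, which forces the signs needed for the
    intermediate value theorem.\<close>
  define b where "b = \<bar>deriv F 0\<bar> / \<omega>"
  have b: "0 \<le> b" "\<omega> * b = \<bar>deriv F 0\<bar>" using \<omega> by (simp_all add: b_def)
  have "deriv F (- b) \<le> 0 \<and> 0 \<le> deriv F b"
  proof (cases "b = 0")
    case False
    with b(1) have "0 < b" by simp
    have "\<omega> * b * b \<le> (deriv F b - deriv F 0) * b"
      using strong[of b 0] by (simp add: power2_eq_square mult.assoc)
    then have "\<omega> * b \<le> deriv F b - deriv F 0" using \<open>0 < b\<close> by (metis mult_le_cancel_right_pos)
    moreover have "\<omega> * b * b \<le> (deriv F 0 - deriv F (- b)) * b"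
      using strong[of 0 "- b"] by (simp add: power2_eq_square mult.assoc)
    then have "\<omega> * b \<le> deriv F 0 - deriv F (- b)" using \<open>0 < b\<close> by (metis mult_le_cancel_right_pos)
    ultimately show ?thesis using b(2) by linarith
  qed (use b in simp)
  then obtain s0 where s0: "deriv F s0 = 0"
    using IVT'[of "deriv F" "- b" 0 b] b(1) continuous_on_subset[OF cont] by auto
  have "F s0 \<le> F s" for s
  proof (cases s s0 rule: linorder_cases)
    case less
    then obtain \<xi> where \<xi>: "s < \<xi>" "\<xi> < s0" "F s0 - F s = (s0 - s) * deriv F \<xi>"
      using MVT2[OF less strongly_convex_has_derivative[OF F]] by blast
    have "0 \<le> \<omega> * \<bar>\<xi> - s0\<bar>\<^sup>2" using \<omega> by simp
    then have "0 \<le> deriv F \<xi> * (\<xi> - s0)" using strong[of \<xi> s0] s0 by simp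
    then have "deriv F \<xi> \<le> 0" using \<xi> by (simp add: zero_le_mult_iff)
    then show ?thesis using \<xi> less mult_nonneg_nonpos[of "s0 - s" "deriv F \<xi>"] by simp
  next
    case greater
    then obtain \<xi> where \<xi>: "s0 < \<xi>" "\<xi> < s" "F s - F s0 = (s - s0) * deriv F \<xi>"
      using MVT2[OF greater strongly_convex_has_derivative[OF F]] by blast
    have "0 \<le> \<omega> * \<bar>\<xi> - s0\<bar>\<^sup>2" using \<omega> by simp
    then have "0 \<le> deriv F \<xi> * (\<xi> - s0)" using strong[of \<xi> s0] s0 by simp
    then have "0 \<le> deriv F \<xi>" using \<xi> by (simp add: zero_le_mult_iff)
    then have "0 \<le> (s - s0) * deriv F \<xi>" using greater by simp
    then show ?thesis using \<xi> by linarith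
  qed simp
  then have "is_arg_min F (\<lambda>s. True) s0" by (simp add: is_arg_min_linorder)
  then have "is_arg_min F (\<lambda>s. True) (ARG_MIN F s. True)"
    unfolding arg_min_def by (rule someI)
  then have "F (ARG_MIN F s. True) \<le> F s" for s by (simp add: is_arg_min_linorder)
  then show ?thesis
    by (intro DERIV_local_min[OF strongly_convex_has_derivative[OF F], of 1]) auto
qed

section \<open>Block systems and observability\<close>

definition stack :: "real^'n \<Rightarrow> real^'m \<Rightarrow> real^('n + 'm)" where
  "stack u v = (\<chi> k. case k of Inl i \<Rightarrow> u $ i | Inr j \<Rightarrow> v $ j)"

lemma stack_nth [simp]: "stack u v $ Inl i = u $ i" "stack u v $ Inr j = v $ j"
  by (simp_all add: stack_def)

lemma sum_UNIV_Plus: "(\<Sum>k\<in>UNIV. g k) = (\<Sum>i\<in>UNIV. g (Inl i)) + (\<Sum>j\<in>UNIV. g (Inr j))"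
  for g :: "'n::finite + 'm::finite \<Rightarrow> real"
  using sum.Plus[of UNIV UNIV g] by simp

lemma row_block_mult_stack: "row_block P Q *v stack u v = P *v u + Q *v v"
  by (simp add: vec_eq_iff row_block_def matrix_vector_mult_def sum_UNIV_Plus)

lemma block_matrix_mult_stack:
  "block_matrix P Q R S *v stack u v = stack (P *v u + Q *v v) (R *v u + S *v v)"
proof -
  have "(block_matrix P Q R S *v stack u v) $ k = stack (P *v u + Q *v v) (R *v u + S *v v) $ k" for k
    by (cases k) (simp_all add: block_matrix_def col_block_def row_block_def matrix_vector_mult_def sum_UNIV_Plus)
  then show ?thesis by (simp add: vec_eq_iff)
qed

text \<open>By compactness of the unit sphere, finitely many output times already distinguish every
  direction from 0. Their summed norm is bounded below by a multiple of the state norm, so a finite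
  window of outputs bounds the state.\<close>

lemma bounded_of_bounded_output:
  fixes E :: "real^'n^'m" and S :: "real^'n^'n" and w :: "nat \<Rightarrow> real^'n"
  assumes obs: "\<And>v. (\<And>t. E *v ((*v) S ^^ t) v = 0) \<Longrightarrow> v = 0"
    and step: "\<And>t. w (Suc t) = S *v w t" and bounded_output: "bounded (range (\<lambda>t. E *v w t))"
  shows "bounded (range w)"
proof -
  define Y where "Y t v = E *v ((*v) S ^^ t) v" for t v
  have lin: "linear (Y t)" for t
  proof (induction t)
    case 0
    then show ?case by (simp add: Y_def[abs_def])
  next
    case (Suc t)
    have "Y (Suc t) = Y t \<circ> (*v) S" by (simp add: Y_def fun_eq_iff funpow_swap1)
    then show ?case using linear_compose[OF matrix_vector_mul_linear Suc, of S] by (simp only:)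
  qed
  have cont: "continuous_on UNIV (Y t)" for t
    using lin by (simp add: linear_continuous_on linear_conv_bounded_linear)
  have "open {v. Y t v \<noteq> 0}" for t
    using cont by (intro open_Collect_neq) auto
  moreover have "sphere 0 1 \<subseteq> (\<Union>t\<in>UNIV. {v. Y t v \<noteq> 0})" 
  proof
    fix v :: "real^'n" assume "v \<in> sphere 0 1"
    then have "v \<noteq> 0" by auto
    then show "v \<in> (\<Union>t\<in>UNIV. {v. Y t v \<noteq> 0})" using obs[of v] by (auto simp: Y_def)
  qed
  ultimately obtain I where I: "finite I" "sphere 0 1 \<subseteq> (\<Union>t\<in>I. {v. Y t v \<noteq> 0})"
    using compactE_image[OF compact_sphere[of "0 :: real^'n" 1], of UNIV "\<lambda>t. {v. Y t v \<noteq> 0}"] by metis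
  define g where "g v = (\<Sum>t\<in>I. norm (Y t v))" for v
  have g_pos: "0 < g v" if "v \<in> sphere 0 1" for v
  proof -
    from that I obtain t where "t \<in> I" "Y t v \<noteq> 0" by blast
    then show ?thesis unfolding g_def using I(1) by (intro sum_pos2[of I t]) auto
  qed
  have "continuous_on (sphere 0 1) g"
    unfolding g_def by (intro continuous_intros continuous_on_subset[OF cont]) auto
  moreover have "sphere 0 1 \<noteq> ({} :: (real^'n) set)" by simp
  ultimately obtain v0 where v0: "v0 \<in> sphere 0 1" "\<And>v. v \<in> sphere 0 1 \<Longrightarrow> g v0 \<le> g v"
    using continuous_attains_inf[OF compact_sphere] by blast
  have below: "g v0 * norm v \<le> g v" for v
  proof (cases "v = 0")
    case False
    have "g v0 \<le> g (v /\<^sub>R norm v)" using False by (intro v0(2)) simp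
    also have "\<dots> = g v / norm v"
      by (simp add: g_def linear_scale[OF lin] divide_inverse mult.commute flip: sum_distrib_left)
    finally show ?thesis using False by (simp add: field_simps)
  qed (simp add: g_def sum_nonneg)
  obtain b where b: "\<And>t. norm (E *v w t) \<le> b" using bounded_output by (auto simp: bounded_iff)
  have iterate: "((*v) S ^^ k) (w t) = w (t + k)" for k t
    by (induction k) (simp_all add: step)
  have "norm (w t) \<le> (\<Sum>k\<in>I. b) / g v0" for t
  proof -
    have "g v0 * norm (w t) \<le> g (w t)" by (rule below)
    also have "\<dots> \<le> (\<Sum>k\<in>I. b)" unfolding g_def Y_def iterate by (intro sum_mono b)
    finally show ?thesis using g_pos[OF v0(1)] by (simp add: pos_le_divide_eq mult.commute)
  qed
  then show ?thesis by (auto simp: bounded_iff)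
qed

text \<open>If \<open>E\<close> never sees the orbit of \<open>v\<close>, the cascade started at
  \<open>stack 0 v\<close> keeps its first block at 0, and its output is indistinguishable from that
  of the zero state.\<close>

lemma observable_cascade_imp:
  fixes C :: "real^'n^'p" and A :: "real^'n^'n" and E :: "real^'m^'n" and S :: "real^'m^'m"
  assumes obs: "observable (row_block C 0) (block_matrix A E 0 S)"
    and v: "\<And>t. E *v ((*v) S ^^ t) v = 0"
  shows "v = 0"
proof -
  have orbit: "((*v) (block_matrix A E 0 S) ^^ t) (stack 0 v) = stack 0 (((*v) S ^^ t) v)" for t
    by (induction t) (simp_all add: block_matrix_mult_stack v)
  have orbit_0: "((*v) (block_matrix A E 0 S) ^^ t) 0 = 0" for t
    by (induction t) simp_all
  have same_output: "row_block C 0 *v ((*v) (block_matrix A E 0 S) ^^ t) (stack 0 v)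
      = row_block C 0 *v ((*v) (block_matrix A E 0 S) ^^ t) 0" for t
    unfolding orbit orbit_0 by (simp add: row_block_mult_stack)
  have "(stack 0 v :: real^('n + 'm)) = 0"
    by (rule obs[unfolded observable_def, rule_format]) (rule same_output)
  then have "(stack 0 v :: real^('n + 'm)) $ Inr j = 0" for j by simp
  then show ?thesis by (simp add: vec_eq_iff)
qed

lemma tendsto_matrix_vector_mult: "((\<lambda>t. A *v g t) \<longlongrightarrow> A *v c) F" if "(g \<longlongrightarrow> c) F" for A :: "real^'n^'m"
  using bounded_linear.tendsto[OF matrix_vector_mul_bounded_linear that] .

lemma bounded_range_matrix_vector_mult: "bounded (range (\<lambda>t. A *v g t))" if "bounded (range g)"
  for A :: "real^'n^'m"
proof -
  have "bounded ((*v) A ` range g)" using that by (intro bounded_linear_image) auto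
  then show ?thesis unfolding image_image .
qed

section \<open>Optimal output consensus\<close>

text \<open>Trajectories are any sequences satisfying the recursions, so all initial values are
  covered. With at least two agents, \<open>ev 2\<close> is an entry of the eigenvalue list.\<close>

theorem theorem1:
  fixes A :: "real^'nx^'nx" and B :: "real^'nu^'nx" and C :: "real^'nx^1"
    and E :: "real^'nw^'nx" and S :: "real^'nw^'nw"
    and f :: "'N::finite \<Rightarrow> real \<Rightarrow> real" and a :: "real^'N^'N" and ev :: "nat \<Rightarrow> real"
    and X1 :: "real^1^'nx" and X2 :: "real^'nw^'nx" and U1 :: "real^1^'nu" and U2 :: "real^'nw^'nu"
    and K :: "real^'nx^'nu" and K1 :: "real^1^'nu" and K2 :: "real^'nw^'nu"
    and L1 :: "real^1^'nx" and L2 :: "real^1^'nw"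
    and l lbar \<alpha> \<beta> \<gamma> :: real
    and x xt :: "'N \<Rightarrow> nat \<Rightarrow> real^'nx" and u :: "'N \<Rightarrow> nat \<Rightarrow> real^'nu"
    and w wt :: "'N \<Rightarrow> nat \<Rightarrow> real^'nw" and d :: "'N \<Rightarrow> nat \<Rightarrow> real^'nx"
    and y z \<Lambda> :: "'N \<Rightarrow> nat \<Rightarrow> real"
  assumes N: "CARD('N) \<ge> 2"
    and minimal: "minimal_triple C A B"
    and S: "\<forall>\<mu> \<in> complex_eigenvalues S. \<not> cmod \<mu> < 1"
    and convex: "\<And>i. strongly_convex l (f i)"
    and Lipschitz: "\<And>i. lbar-lipschitz_on UNIV (deriv (f i))"
    and graph: "adjacency_matrix a" "strongly_connected a" "weight_balanced a"
    and regulator1: "X1 = A ** X1 + B ** U1" "mat 1 = C ** X1"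
    and regulator2: "X2 ** S = A ** X2 + B ** U2 + E" "0 = C ** X2"
    and obs: "observable (row_block C 0) (block_matrix A E 0 S)"
    and ev: "ordered_eigenvalues (Sym (Laplacian a)) ev"
    and K: "Schur_stable (A + B ** K)" "K1 = U1 - K ** X1" "K2 = U2 - K ** X2"
    and L: "Schur_stable (block_matrix (A + L1 ** C) E (L2 ** C) S)"
    and \<alpha>: "\<alpha> \<ge> Max {1, 1 / l, 2 * lbar\<^sup>2 / (l * ev 2)}"
    and \<beta>: "\<beta> \<ge> Max {1, 4 * \<alpha>\<^sup>2 * (ev CARD('N))\<^sup>2 / (ev 2)\<^sup>2}"
    and \<gamma>: "0 < \<gamma>" "\<gamma> < 1 / (\<beta>^4 * ((ev CARD('N))\<^sup>2 + lbar\<^sup>2))"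
    and agents: "\<And>i t. x i (Suc t) = A *v x i t + B *v u i t + d i t"
      "\<And>i t. y i t = (C *v x i t) $ 1"
    and disturbances: "\<And>i t. d i t = E *v w i t" "\<And>i t. w i (Suc t) = S *v w i t"
    and controller:
      "\<And>i t. u i t = K *v xt i t + K1 *v vec (z i t) + K2 *v wt i t"
      "\<And>i t. xt i (Suc t) =
         (A + L1 ** C) *v xt i t + B *v u i t + E *v wt i t - L1 *v vec (y i t)"
      "\<And>i t. wt i (Suc t) = S *v wt i t + L2 *v (C *v xt i t - vec (y i t))"
      "\<And>i t. z i (Suc t) =
         z i t - \<gamma> * (\<alpha> * deriv (f i) (z i t) + \<beta> * (\<Sum>j\<in>UNIV. a $ i $ j * (z i t - z j t))
                       + (\<Sum>j\<in>UNIV. a $ i $ j * (\<Lambda> i t - \<Lambda> j t)))"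
      "\<And>i t. \<Lambda> i (Suc t) = \<Lambda> i t + \<gamma> * \<alpha> * \<beta> * (\<Sum>j\<in>UNIV. a $ i $ j * (z i t - z j t))"
  shows "(\<forall>i. bounded (range (z i)) \<and> bounded (range (\<Lambda> i)) \<and> bounded (range (y i)) \<and>
            (bounded (range (d i)) \<longrightarrow>
               bounded (range (x i)) \<and> bounded (range (u i)) \<and>
               bounded (range (xt i)) \<and> bounded (range (wt i)))) \<and>
         (\<forall>i. (\<lambda>t. \<bar>y i t - (ARG_MIN (\<lambda>s. \<Sum>j\<in>UNIV. f j s) s. True)\<bar>) \<longlonglongrightarrow> 0)"
proof -
  define ystar where "ystar = (ARG_MIN (\<lambda>s. \<Sum>j\<in>UNIV. f j s) s. True)"
  interpret balanced_digraph a using graph by unfold_locales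
  have strong: "l * \<bar>s1 - s2\<bar>\<^sup>2 \<le> (deriv (f i) s1 - deriv (f i) s2) * (s1 - s2)" for i s1 s2
    using convex[of i] by (simp add: strongly_convex_def)
  have lip: "\<bar>deriv (f i) s1 - deriv (f i) s2\<bar> \<le> lbar * \<bar>s1 - s2\<bar>" for i s1 s2
    using lipschitz_onD[OF Lipschitz, of s1 s2 i] by (simp add: dist_real_def)
  have l_pos: "0 < l" using convex by (auto simp: strongly_convex_def)
  have l_le: "l \<le> lbar"
  proof -
    obtain i :: 'N where True by blast
    show ?thesis using strong[of 1 0 i] lip[of i 1 0] by simp
  qed
  have ev2: "0 < ev 2" by (rule second_eigenvalue_pos[OF ev N])
  have ev_mono: "ev 2 \<le> ev CARD('N)"
    using ev N unfolding ordered_eigenvalues_def by (auto elim!: mono_onD)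
  interpret gain_conditions \<alpha> \<beta> \<gamma> l lbar "ev 2" "ev CARD('N)"
  proof
    from \<alpha> have \<alpha>': "1 \<le> \<alpha>" "1 / l \<le> \<alpha>" "2 * lbar\<^sup>2 / (l * ev 2) \<le> \<alpha>" by simp_all
    show "1 \<le> \<alpha>" by (fact \<alpha>'(1))
    show "1 \<le> \<alpha> * l" using \<alpha>'(2) l_pos by (simp add: pos_divide_le_eq)
    show "2 * lbar\<^sup>2 \<le> \<alpha> * l * ev 2" using \<alpha>'(3) l_pos ev2 by (simp add: pos_divide_le_eq mult.assoc)
    from \<beta> have \<beta>': "1 \<le> \<beta>" "4 * \<alpha>\<^sup>2 * (ev CARD('N))\<^sup>2 / (ev 2)\<^sup>2 \<le> \<beta>" by simp_all
    show "4 * \<alpha>\<^sup>2 * (ev CARD('N))\<^sup>2 \<le> \<beta> * (ev 2)\<^sup>2" using \<beta>'(2) ev2 by (simp add: pos_divide_le_eq)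
    have "0 < \<beta>^4 * ((ev CARD('N))\<^sup>2 + lbar\<^sup>2)"
      using \<beta>'(1) l_pos l_le by (intro mult_pos_pos add_nonneg_pos) auto
    then show "\<gamma> * (\<beta>^4 * ((ev CARD('N))\<^sup>2 + lbar\<^sup>2)) < 1" using \<gamma>(2) by (simp add: pos_less_divide_eq)
  qed (fact l_pos l_le ev2 ev_mono \<gamma>(1))+
  define G :: "real^'N \<Rightarrow> real^'N" where "G v = (\<chi> i. deriv (f i) (v $ i))" for v
  define zv :: "nat \<Rightarrow> real^'N" where "zv t = (\<chi> i. z i t)" for t
  define \<Lambda>v :: "nat \<Rightarrow> real^'N" where "\<Lambda>v t = (\<chi> i. \<Lambda> i t)" for t
  interpret primal_dual a ev \<alpha> \<beta> \<gamma> l lbar G zv \<Lambda>v ystar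
  proof
    show "l * ((u - v) \<bullet> (u - v)) \<le> (u - v) \<bullet> (G u - G v)" for u v
      using strong by (simp add: inner_vec_def G_def sum_distrib_left power2_eq_square mult_ac sum_mono)
    show "(G u - G v) \<bullet> (G u - G v) \<le> lbar\<^sup>2 * ((u - v) \<bullet> (u - v))" for u v
    proof -
      have "(deriv (f i) (u $ i) - deriv (f i) (v $ i))\<^sup>2 \<le> lbar\<^sup>2 * (u $ i - v $ i)\<^sup>2" for i
        using power_mono[OF lip[of i "u $ i" "v $ i"], of 2] by (simp add: power_mult_distrib)
      then show ?thesis
        by (simp add: inner_vec_def G_def sum_distrib_left flip: power2_eq_square) (simp add: sum_mono)
    qed
    have sum_deriv: "deriv (\<lambda>s. \<Sum>j\<in>UNIV. f j s) = (\<lambda>s. \<Sum>j\<in>UNIV. deriv (f j) s)"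
      using deriv_sum_strongly_convex[of UNIV l f] convex by (intro ext DERIV_imp_deriv) auto
    have "deriv (\<lambda>s. \<Sum>j\<in>UNIV. f j s) ystar = 0"
      unfolding ystar_def
    proof (rule deriv_arg_min_strongly_convex)
      show "strongly_convex l (\<lambda>s. \<Sum>j\<in>UNIV. f j s)" using convex by (intro strongly_convex_sum) auto
      show "continuous_on UNIV (deriv (\<lambda>s. \<Sum>j\<in>UNIV. f j s))"
        unfolding sum_deriv using Lipschitz by (intro continuous_on_sum lipschitz_on_continuous_on)
    qed
    then show "1 \<bullet> G (ystar *\<^sub>R 1) = 0" by (simp add: sum_deriv inner_vec_def G_def)
    show "zv (Suc t) = zv t - \<gamma> *\<^sub>R (\<alpha> *\<^sub>R G (zv t) + \<beta> *\<^sub>R (Laplacian a *v zv t) + Laplacian a *v \<Lambda>v t)" for t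
      by (simp add: vec_eq_iff Laplacian_mult controller zv_def \<Lambda>v_def G_def)
    show "\<Lambda>v (Suc t) = \<Lambda>v t + (\<gamma> * \<alpha> * \<beta>) *\<^sub>R (Laplacian a *v zv t)" for t
      by (simp add: vec_eq_iff Laplacian_mult controller zv_def \<Lambda>v_def)
  qed (use N ev in auto)
  have z_lim: "z i \<longlonglongrightarrow> ystar" for i
    using tendsto_vec_nth[OF primal_converges, of i] by (simp add: zv_def)
  have \<Lambda>_bounded: "bounded (range (\<Lambda> i))" for i
  proof -
    have "bounded ((\<lambda>v. v $ i) ` range \<Lambda>v)"
      using dual_bounded by (intro bounded_linear_image bounded_linear_vec_nth)
    then show ?thesis by (simp add: image_image \<Lambda>v_def)
  qed
  define \<zeta> :: "'N \<Rightarrow> nat \<Rightarrow> real^1" where "\<zeta> i t = vec (z i t)" for i t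
  define xe where "xe i t = xt i t - x i t" for i t
  define we where "we i t = wt i t - w i t" for i t
  \<comment> \<open>The deviation from a moving target: with \<open>z\<close> in place of the
    minimizer, the transient of \<open>z\<close> enters only through its increments.\<close>
  define \<xi> where "\<xi> i t = x i t - X1 *v \<zeta> i t - X2 *v w i t" for i t
  have \<zeta>_lim: "\<zeta> i \<longlonglongrightarrow> vec ystar" for i
    unfolding \<zeta>_def vec_def by (intro tendsto_vec_lambda z_lim)
  have y_vec: "vec (y i t) = C *v x i t" for i t
    by (simp add: vec_eq_iff agents(2))
  have observer: "stack (xe i (Suc t)) (we i (Suc t))
      = block_matrix (A + L1 ** C) E (L2 ** C) S *v stack (xe i t) (we i t)" for i t
  proof -
    have "xe i (Suc t) = (A + L1 ** C) *v xe i t + E *v we i t"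
      by (simp add: xe_def we_def controller(2) agents(1) disturbances(1) y_vec matrix_vector_mult_diff_distrib
        matrix_vector_mult_add_rdistrib matrix_vector_mul_assoc)
    moreover have "we i (Suc t) = (L2 ** C) *v xe i t + S *v we i t"
      by (simp add: xe_def we_def controller(3) disturbances(2) y_vec matrix_vector_mult_diff_distrib
        matrix_vector_mul_assoc[symmetric])
    ultimately show ?thesis by (simp add: block_matrix_mult_stack)
  qed
  have "(\<lambda>t. stack (xe i t) (we i t)) \<longlonglongrightarrow> 0" for i
    by (rule Schur_stable_tendsto_zero[OF L, of _ "\<lambda>t. 0"]) (simp_all add: observer)
  from tendsto_vec_nth[OF this]
  have component_lim: "(\<lambda>t. stack (xe i t) (we i t) $ k) \<longlonglongrightarrow> 0" for i k by simp
  have xe_lim: "xe i \<longlonglongrightarrow> 0" for i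
    using component_lim[of i "Inl _"] by (intro vec_tendstoI) simp
  have we_lim: "we i \<longlonglongrightarrow> 0" for i
    using component_lim[of i "Inr _"] by (intro vec_tendstoI) simp
  define b where "b i t = B *v (K *v xe i t) + B *v (K2 *v we i t) - X1 *v (\<zeta> i (Suc t) - \<zeta> i t)" for i t
  have \<xi>_step: "\<xi> i (Suc t) = (A + B ** K) *v \<xi> i t + b i t" for i t
  proof -
    \<comment> \<open>The regulator equations are oriented to eliminate
      \<open>A *v (X1 *v v)\<close> and \<open>X2 *v (S *v v)\<close>; the feedforward terms
      \<open>U1\<close>, \<open>U2\<close> then cancel.\<close>
    have X1: "A *v (X1 *v v) = X1 *v v - B *v (U1 *v v)" for v
      using arg_cong[OF regulator1(1), of "\<lambda>M. M *v v"]
      by (simp add: matrix_vector_mult_add_rdistrib matrix_vector_mul_assoc[symmetric] algebra_simps)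
    have X2: "X2 *v (S *v v) = A *v (X2 *v v) + B *v (U2 *v v) + E *v v" for v
      using arg_cong[OF regulator2(1), of "\<lambda>M. M *v v"]
      by (simp add: matrix_vector_mult_add_rdistrib matrix_vector_mul_assoc[symmetric])
    have xt: "xt i t = x i t + xe i t" and wt: "wt i t = w i t + we i t"
      by (simp_all add: xe_def we_def)
    show ?thesis
      unfolding \<xi>_def b_def agents(1) controller(1) xt wt disturbances \<zeta>_def[symmetric] K(2,3) X2
      by (simp add: X1 matrix_vector_mult_diff_distrib matrix_vector_right_distrib
        matrix_vector_mult_add_rdistrib matrix_vector_mult_diff_rdistrib matrix_vector_mul_assoc[symmetric])
  qed
  have \<xi>_lim: "\<xi> i \<longlonglongrightarrow> 0" for i
  proof (rule Schur_stable_tendsto_zero[OF K(1)])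
    show "\<xi> i (Suc t) = (A + B ** K) *v \<xi> i t + b i t" for t by (rule \<xi>_step)
    have "b i \<longlonglongrightarrow> B *v (K *v 0) + B *v (K2 *v 0) - X1 *v (vec ystar - vec ystar)"
      unfolding b_def
      by (intro tendsto_intros tendsto_matrix_vector_mult xe_lim we_lim \<zeta>_lim LIMSEQ_Suc)
    then show "b i \<longlonglongrightarrow> 0" by simp
  qed
  have y_eq: "y i t = (C *v \<xi> i t) $ 1 + z i t" for i t
  proof -
    have "C *v \<xi> i t = C *v x i t - \<zeta> i t"
      by (simp add: \<xi>_def matrix_vector_mult_diff_distrib matrix_vector_mul_assoc
        regulator1(2)[symmetric] regulator2(2)[symmetric])
    then show ?thesis by (simp add: agents(2) \<zeta>_def)
  qed
  have y_lim: "y i \<longlonglongrightarrow> ystar" for i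
  proof -
    have "(\<lambda>t. (C *v \<xi> i t) $ 1 + z i t) \<longlonglongrightarrow> (C *v 0) $ 1 + ystar"
      by (intro tendsto_intros tendsto_matrix_vector_mult \<xi>_lim z_lim)
    then show ?thesis by (simp flip: y_eq)
  qed
  have bounded_states: "bounded (range (x i)) \<and> bounded (range (u i)) \<and>
      bounded (range (xt i)) \<and> bounded (range (wt i))" if d: "bounded (range (d i))" for i
  proof -
    have "bounded (range (\<lambda>t. E *v w i t))" using d by (simp flip: disturbances(1))
    with observable_cascade_imp[OF obs] disturbances(2) have w: "bounded (range (w i))"
      by (rule bounded_of_bounded_output)
    note lims = convergent_imp_bounded[OF \<xi>_lim[of i]] convergent_imp_bounded[OF \<zeta>_lim[of i]]
      convergent_imp_bounded[OF xe_lim[of i]] convergent_imp_bounded[OF we_lim[of i]]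
    have "bounded (range (\<lambda>t. \<xi> i t + X1 *v \<zeta> i t + X2 *v w i t))"
      by (intro bounded_plus_comp bounded_range_matrix_vector_mult lims w)
    then have x: "bounded (range (x i))" by (simp add: \<xi>_def)
    have "bounded (range (\<lambda>t. xe i t + x i t))" by (intro bounded_plus_comp lims x)
    then have xt: "bounded (range (xt i))" by (simp add: xe_def)
    have "bounded (range (\<lambda>t. we i t + w i t))" by (intro bounded_plus_comp lims w)
    then have wt: "bounded (range (wt i))" by (simp add: we_def)
    have "bounded (range (\<lambda>t. K *v xt i t + K1 *v \<zeta> i t + K2 *v wt i t))"
      by (intro bounded_plus_comp bounded_range_matrix_vector_mult lims xt wt)
    moreover have "u i = (\<lambda>t. K *v xt i t + K1 *v \<zeta> i t + K2 *v wt i t)"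
      by (simp add: fun_eq_iff controller(1) \<zeta>_def)
    ultimately have "bounded (range (u i))" by simp
    with x xt wt show ?thesis by blast
  qed
  show ?thesis
    unfolding ystar_def[symmetric]
    using convergent_imp_bounded[OF z_lim] convergent_imp_bounded[OF y_lim] \<Lambda>_bounded bounded_states
      tendsto_rabs_zero[OF LIM_zero[OF y_lim]] by blast
qed

end
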